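(* Let $(\bar a_i)_{i\in I}$ and $(\bar b_j)_{j\in J}$ be sequences of indiscernibles. (1) The algebraic kernel is a $\approx$-invariant: if $(\bar a_i)_{i\in I}\approx(\bar b_j)_{j\in J}$, then $\operatorname{aker}(\bar a_i)_{i\in I}=\operatorname{aker}(\bar b_j)_{j\in J}$. (2) If $(\bar a_i)_{i\in I}$ and $(\bar b_j)_{j\in J}$ are cleanly collinear, then $\operatorname{aker}(\bar a_i)_{i\in I}=\operatorname{acl}(\{\bar a_i\mid i\in I\})\cap\operatorname{acl}(\{\bar b_j\mid j\in J\})$. (3) $\operatorname{aker}(\bar a_i)_{i\in I}=\operatorname{acl}\operatorname{aker}(\bar a_i)_{i\in I}$. (4) $(\bar a_i)_{i\in I}$ is indiscernible over $\operatorname{aker}(\bar a_i)_{i\in I}$.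
   Context: $T$ is a complete consistent first-order theory (possibly many-sorted); we work in a big saturated model of $T$, with algebraic closure $\operatorname{acl}$. Tuples may be infinite, and $\operatorname{acl}(\{\bar a_i\mid i\in I\})$ means the algebraic closure of the set of all entries of all tuples $\bar a_i$. Sequences of indiscernibles are indexed by arbitrary infinite (small) linearly ordered sets. The algebraic kernel of a sequence of indiscernibles $(\bar a_i)_{i\in I}$ is the set $$\operatorname{aker}(\bar a_i)_{i\in I}=\{d\mid d\in\operatorname{acl}(\{\bar a_i\mid i\in I\})\text{ and }(\bar a_i)_{i\in I}\text{ is indiscernible over }d\}$$ (where $d$ ranges over single elements). Two sequences of indiscernibles $(\bar a_i)_{i\in I}$ and $(\bar b_j)_{j\in J}$ are cleanly collinear if one of their two concatenations (the sequence indexed by the disjoint union $I+J$ ordered so that $I<J$, or the one indexed by $J+I$ with $J<I$) is indiscernible. $\approx$ denotes the transitive closure of clean collinearity. *)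

theory Defs
  imports Main
begin

unbundle cardinal_syntax

section \<open>Many-sorted first-order logic\<close>

text \<open>Every element of the type \<open>'s\<close> is a sort. The symbols are given by sets, so that
  languages without function symbols or without relation symbols are included.\<close>

record ('s, 'f, 'r) language =
  funs :: "'f set"
  rels :: "'r set"
  fun_args :: "'f \<Rightarrow> 's list"
  fun_res :: "'f \<Rightarrow> 's"
  rel_args :: "'r \<Rightarrow> 's list"

type_synonym 's var = "'s \<times> nat"

datatype ('s, 'f) tm = Var "'s var" | App 'f "('s, 'f) tm list"

datatype ('s, 'f, 'r) fm =
    Eq "('s, 'f) tm" "('s, 'f) tm"
  | Rel 'r "('s, 'f) tm list"
  | Neg "('s, 'f, 'r) fm"
  | Conj "('s, 'f, 'r) fm" "('s, 'f, 'r) fm"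
  | Ex "'s var" "('s, 'f, 'r) fm"

fun tm_sort :: "('s, 'f, 'r) language \<Rightarrow> ('s, 'f) tm \<Rightarrow> 's" where
  "tm_sort L (Var v) = fst v"
| "tm_sort L (App f ts) = fun_res L f"

fun wf_tm :: "('s, 'f, 'r) language \<Rightarrow> ('s, 'f) tm \<Rightarrow> bool" where
  "wf_tm L (Var v) \<longleftrightarrow> True"
| "wf_tm L (App f ts) \<longleftrightarrow>
     f \<in> funs L \<and> map (tm_sort L) ts = fun_args L f \<and> (\<forall>t\<in>set ts. wf_tm L t)"

fun wf_fm :: "('s, 'f, 'r) language \<Rightarrow> ('s, 'f, 'r) fm \<Rightarrow> bool" where
  "wf_fm L (Eq t u) \<longleftrightarrow> wf_tm L t \<and> wf_tm L u \<and> tm_sort L t = tm_sort L u"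
| "wf_fm L (Rel R ts) \<longleftrightarrow>
     R \<in> rels L \<and> map (tm_sort L) ts = rel_args L R \<and> (\<forall>t\<in>set ts. wf_tm L t)"
| "wf_fm L (Neg \<phi>) \<longleftrightarrow> wf_fm L \<phi>"
| "wf_fm L (Conj \<phi> \<psi>) \<longleftrightarrow> wf_fm L \<phi> \<and> wf_fm L \<psi>"
| "wf_fm L (Ex v \<phi>) \<longleftrightarrow> wf_fm L \<phi>"

fun vars_tm :: "('s, 'f) tm \<Rightarrow> 's var set" where
  "vars_tm (Var v) = {v}"
| "vars_tm (App f ts) = (\<Union>t\<in>set ts. vars_tm t)"

fun fv :: "('s, 'f, 'r) fm \<Rightarrow> 's var set" where
  "fv (Eq t u) = vars_tm t \<union> vars_tm u"
| "fv (Rel R ts) = (\<Union>t\<in>set ts. vars_tm t)"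
| "fv (Neg \<phi>) = fv \<phi>"
| "fv (Conj \<phi> \<psi>) = fv \<phi> \<union> fv \<psi>"
| "fv (Ex v \<phi>) = fv \<phi> - {v}"

definition sentences :: "('s, 'f, 'r) language \<Rightarrow> ('s, 'f, 'r) fm set" where
  "sentences L = {\<phi>. wf_fm L \<phi> \<and> fv \<phi> = {}}"

record ('s, 'f, 'r, 'm) struct =
  dom :: "'s \<Rightarrow> 'm set"
  fun_int :: "'f \<Rightarrow> 'm list \<Rightarrow> 'm"
  rel_int :: "'r \<Rightarrow> 'm list \<Rightarrow> bool"

definition univ :: "('s, 'f, 'r, 'm) struct \<Rightarrow> 'm set" where
  "univ M = (\<Union>s. dom M s)"

definition is_struct :: "('s, 'f, 'r) language \<Rightarrow> ('s, 'f, 'r, 'm) struct \<Rightarrow> bool" where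
  "is_struct L M \<longleftrightarrow>
     (\<forall>s. dom M s \<noteq> {}) \<and>
     (\<forall>s s'. s \<noteq> s' \<longrightarrow> dom M s \<inter> dom M s' = {}) \<and>
     (\<forall>f\<in>funs L. \<forall>ds. list_all2 (\<lambda>d s. d \<in> dom M s) ds (fun_args L f) \<longrightarrow>
        fun_int M f ds \<in> dom M (fun_res L f))"

text \<open>Meaningful for \<open>d \<in> univ M\<close> only, where the sort is unique by disjointness.\<close>

definition sort_of :: "('s, 'f, 'r, 'm) struct \<Rightarrow> 'm \<Rightarrow> 's" where
  "sort_of M d = (THE s. d \<in> dom M s)"

fun tm_val :: "('s, 'f, 'r, 'm) struct \<Rightarrow> ('s var \<Rightarrow> 'm) \<Rightarrow> ('s, 'f) tm \<Rightarrow> 'm" where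
  "tm_val M e (Var v) = e v"
| "tm_val M e (App f ts) = fun_int M f (map (tm_val M e) ts)"

fun holds :: "('s, 'f, 'r, 'm) struct \<Rightarrow> ('s var \<Rightarrow> 'm) \<Rightarrow> ('s, 'f, 'r) fm \<Rightarrow> bool" where
  "holds M e (Eq t u) \<longleftrightarrow> tm_val M e t = tm_val M e u"
| "holds M e (Rel R ts) \<longleftrightarrow> rel_int M R (map (tm_val M e) ts)"
| "holds M e (Neg \<phi>) \<longleftrightarrow> \<not> holds M e \<phi>"
| "holds M e (Conj \<phi> \<psi>) \<longleftrightarrow> holds M e \<phi> \<and> holds M e \<psi>"
| "holds M e (Ex v \<phi>) \<longleftrightarrow> (\<exists>d\<in>dom M (fst v). holds M (e(v := d)) \<phi>)"


section \<open>Complete consistent theories\<close>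

text \<open>For sentences the assignment \<open>e\<close> is irrelevant.\<close>

definition is_model ::
  "('s, 'f, 'r) language \<Rightarrow> ('s, 'f, 'r, 'm) struct \<Rightarrow> ('s, 'f, 'r) fm set \<Rightarrow> bool" where
  "is_model L M T \<longleftrightarrow> is_struct L M \<and> (\<forall>\<phi>\<in>T. \<forall>e. holds M e \<phi>)"

text \<open>Consistency and consequence refer to models whose universe is a subset of the type of
  formulas. That type has at least \<open>|L| + \<aleph>\<^sub>0\<close> elements, so by the downward
  Loewenheim-Skolem theorem this amounts to considering models of arbitrary size.\<close>

definition consistent :: "('s, 'f, 'r) language \<Rightarrow> ('s, 'f, 'r) fm set \<Rightarrow> bool" where
  "consistent L T \<longleftrightarrow> (\<exists>M :: ('s, 'f, 'r, ('s, 'f, 'r) fm) struct. is_model L M T)"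

definition entails ::
  "('s, 'f, 'r) language \<Rightarrow> ('s, 'f, 'r) fm set \<Rightarrow> ('s, 'f, 'r) fm \<Rightarrow> bool" where
  "entails L T \<phi> \<longleftrightarrow>
     (\<forall>M :: ('s, 'f, 'r, ('s, 'f, 'r) fm) struct. is_model L M T \<longrightarrow> is_model L M {\<phi>})"

definition complete_consistent_theory ::
  "('s, 'f, 'r) language \<Rightarrow> ('s, 'f, 'r) fm set \<Rightarrow> bool" where
  "complete_consistent_theory L T \<longleftrightarrow>
     T \<subseteq> sentences L \<and> consistent L T \<and>
     (\<forall>\<phi>\<in>sentences L. entails L T \<phi> \<or> entails L T (Neg \<phi>))"


section \<open>Types, saturation, algebraic closure\<close>

text \<open>A formula over \<open>A\<close> in variables \<open>x \<in> X\<close> of sort \<open>\<sigma> x\<close> is a formula \<open>\<phi>\<close> together with a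
  map \<open>\<rho>\<close> replacing each free variable of \<open>\<phi>\<close> by some \<open>x \<in> X\<close> or by a parameter from \<open>A\<close>. The
  set \<open>X\<close> may be infinite and of any size.\<close>

type_synonym ('s, 'f, 'r, 'm, 'x) pfm = "('s, 'f, 'r) fm \<times> ('s var \<Rightarrow> 'x + 'm)"

definition pfms :: "('s, 'f, 'r) language \<Rightarrow> ('s, 'f, 'r, 'm) struct \<Rightarrow> 'm set \<Rightarrow>
    'x set \<Rightarrow> ('x \<Rightarrow> 's) \<Rightarrow> ('s, 'f, 'r, 'm, 'x) pfm set" where
  "pfms L M A X \<sigma> =
     {(\<phi>, \<rho>). wf_fm L \<phi> \<and>
        (\<forall>v\<in>fv \<phi>. case \<rho> v of
             Inl x \<Rightarrow> x \<in> X \<and> \<sigma> x = fst v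
           | Inr b \<Rightarrow> b \<in> A \<and> b \<in> dom M (fst v))}"

fun pholds :: "('s, 'f, 'r, 'm) struct \<Rightarrow> ('x \<Rightarrow> 'm) \<Rightarrow> ('s, 'f, 'r, 'm, 'x) pfm \<Rightarrow> bool" where
  "pholds M p (\<phi>, \<rho>) \<longleftrightarrow> holds M (\<lambda>v. case \<rho> v of Inl x \<Rightarrow> p x | Inr b \<Rightarrow> b) \<phi>"

definition tp :: "('s, 'f, 'r) language \<Rightarrow> ('s, 'f, 'r, 'm) struct \<Rightarrow> 'm set \<Rightarrow>
    'x set \<Rightarrow> ('x \<Rightarrow> 'm) \<Rightarrow> ('s, 'f, 'r, 'm, 'x) pfm set" where
  "tp L M A X p = {\<theta> \<in> pfms L M A X (\<lambda>x. sort_of M (p x)). pholds M p \<theta>}"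

definition acl :: "('s, 'f, 'r) language \<Rightarrow> ('s, 'f, 'r, 'm) struct \<Rightarrow> 'm set \<Rightarrow> 'm set" where
  "acl L M A =
     {d \<in> univ M. \<exists>\<theta> \<in> pfms L M A {()} (\<lambda>_. sort_of M d).
        pholds M (\<lambda>_. d) \<theta> \<and> finite {c \<in> dom M (sort_of M d). pholds M (\<lambda>_. c) \<theta>}}"

definition realized_in_sort ::
  "('s, 'f, 'r, 'm) struct \<Rightarrow> 's \<Rightarrow> ('s, 'f, 'r, 'm, unit) pfm set \<Rightarrow> bool" where
  "realized_in_sort M s \<Phi> \<longleftrightarrow> (\<exists>d\<in>dom M s. \<forall>\<theta>\<in>\<Phi>. pholds M (\<lambda>_. d) \<theta>)"

definition saturated ::
  "'k rel \<Rightarrow> ('s, 'f, 'r) language \<Rightarrow> ('s, 'f, 'r, 'm) struct \<Rightarrow> bool" where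
  "saturated \<kappa> L M \<longleftrightarrow>
     (\<forall>A s \<Phi>. A \<subseteq> univ M \<and> |A| <o \<kappa> \<and> \<Phi> \<subseteq> pfms L M A {()} (\<lambda>_. s) \<and>
        (\<forall>\<Psi>. finite \<Psi> \<and> \<Psi> \<subseteq> \<Phi> \<longrightarrow> realized_in_sort M s \<Psi>) \<longrightarrow>
        realized_in_sort M s \<Phi>)"

text \<open>The cardinal \<open>\<kappa>\<close> is greater than the size of the language, and every infinite sort has
  exactly \<open>\<kappa>\<close> elements. The universe is required to have at most, rather than exactly, \<open>\<kappa>\<close>
  elements in order to admit theories all of whose sorts are finite. ``Small'' means of
  cardinality less than \<open>\<kappa>\<close>.\<close>

definition big_saturated_model :: "'k rel \<Rightarrow> ('s, 'f, 'r) language \<Rightarrow> ('s, 'f, 'r) fm set \<Rightarrow>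
    ('s, 'f, 'r, 'm) struct \<Rightarrow> bool" where
  "big_saturated_model \<kappa> L T M \<longleftrightarrow>
     Card_order \<kappa> \<and> natLeq <o \<kappa> \<and>
     |UNIV :: 's set| <o \<kappa> \<and> |funs L| <o \<kappa> \<and> |rels L| <o \<kappa> \<and>
     is_model L M T \<and> saturated \<kappa> L M \<and> |univ M| \<le>o \<kappa>"


section \<open>Sequences of indiscernibles\<close>

text \<open>A sequence \<open>(r, a)\<close> is indexed by the set \<open>Field r\<close>, linearly ordered by the reflexive
  relation \<open>r\<close>. Its members are tuples \<open>a i\<close> with entries \<open>a i \<nu>\<close> for \<open>\<nu>\<close> in a set \<open>N\<close>; values of
  \<open>a\<close> outside \<open>Field r\<close> and \<open>N\<close> play no role.\<close>

type_synonym ('i, 'n, 'm) seq = "'i rel \<times> ('i \<Rightarrow> 'n \<Rightarrow> 'm)"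

definition entries :: "'n set \<Rightarrow> ('i, 'n, 'm) seq \<Rightarrow> 'm set" where
  "entries N S = {snd S i \<nu> | i \<nu>. i \<in> Field (fst S) \<and> \<nu> \<in> N}"

definition increasing :: "'i rel \<Rightarrow> 'i list \<Rightarrow> bool" where
  "increasing r is \<longleftrightarrow> set is \<subseteq> Field r \<and> sorted_wrt (\<lambda>i j. (i, j) \<in> r \<and> i \<noteq> j) is"

text \<open>The concatenation of the tuples of \<open>a\<close> at the positions \<open>is\<close>, with entries indexed by
  \<open>{..<length is} \<times> N\<close>.\<close>

definition subtuple :: "('i \<Rightarrow> 'n \<Rightarrow> 'm) \<Rightarrow> 'i list \<Rightarrow> nat \<times> 'n \<Rightarrow> 'm" where
  "subtuple a is = (\<lambda>(k, \<nu>). a (is ! k) \<nu>)"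

definition indiscernible_over :: "('s, 'f, 'r) language \<Rightarrow> ('s, 'f, 'r, 'm) struct \<Rightarrow> 'n set \<Rightarrow>
    'm set \<Rightarrow> ('i, 'n, 'm) seq \<Rightarrow> bool" where
  "indiscernible_over L M N B S \<longleftrightarrow>
     (\<forall>is js. increasing (fst S) is \<and> increasing (fst S) js \<and> length is = length js \<longrightarrow>
        tp L M B ({..<length is} \<times> N) (subtuple (snd S) is) =
        tp L M B ({..<length is} \<times> N) (subtuple (snd S) js))"

definition indiscernible_seq :: "'k rel \<Rightarrow> ('s, 'f, 'r) language \<Rightarrow> ('s, 'f, 'r, 'm) struct \<Rightarrow>
    'n set \<Rightarrow> ('i, 'n, 'm) seq \<Rightarrow> bool" where
  "indiscernible_seq \<kappa> L M N S \<longleftrightarrow>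
     Linear_order (fst S) \<and> infinite (Field (fst S)) \<and> |Field (fst S)| <o \<kappa> \<and>
     entries N S \<subseteq> univ M \<and> indiscernible_over L M N {} S"

definition aker :: "('s, 'f, 'r) language \<Rightarrow> ('s, 'f, 'r, 'm) struct \<Rightarrow> 'n set \<Rightarrow>
    ('i, 'n, 'm) seq \<Rightarrow> 'm set" where
  "aker L M N S = {d. d \<in> acl L M (entries N S) \<and> indiscernible_over L M N {d} S}"

definition concat_order :: "'i rel \<Rightarrow> 'j rel \<Rightarrow> ('i + 'j) rel" where
  "concat_order r r' =
     map_prod Inl Inl ` r \<union> map_prod Inr Inr ` r' \<union> (Inl ` Field r) \<times> (Inr ` Field r')"

definition concat_seq ::
  "('i, 'n, 'm) seq \<Rightarrow> ('j, 'n, 'm) seq \<Rightarrow> ('i + 'j, 'n, 'm) seq" where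
  "concat_seq S S' = (concat_order (fst S) (fst S'), case_sum (snd S) (snd S'))"

definition cleanly_collinear :: "'k rel \<Rightarrow> ('s, 'f, 'r) language \<Rightarrow> ('s, 'f, 'r, 'm) struct \<Rightarrow>
    'n set \<Rightarrow> ('i, 'n, 'm) seq \<Rightarrow> ('j, 'n, 'm) seq \<Rightarrow> bool" where
  "cleanly_collinear \<kappa> L M N S S' \<longleftrightarrow>
     indiscernible_seq \<kappa> L M N S \<and> indiscernible_seq \<kappa> L M N S' \<and>
     (indiscernible_over L M N {} (concat_seq S S') \<or>
      indiscernible_over L M N {} (concat_seq S' S))"

text \<open>The intermediate sequences of a chain must range over all small index orders. Here they
  share the index type \<open>'i\<close>; this type is also the type of \<open>\<kappa>\<close>, whence every linear order of
  cardinality less than \<open>\<kappa>\<close> is isomorphic to one on a subset of \<open>'i\<close>.\<close>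

definition approx :: "'i rel \<Rightarrow> ('s, 'f, 'r) language \<Rightarrow> ('s, 'f, 'r, 'm) struct \<Rightarrow>
    'n set \<Rightarrow> ('i, 'n, 'm) seq \<Rightarrow> ('i, 'n, 'm) seq \<Rightarrow> bool" where
  "approx \<kappa> L M N = (cleanly_collinear \<kappa> L M N)\<^sup>+\<^sup>+"

end

theory Submission
  imports Defs "HOL-Library.FuncSet"
begin

text \<open>The kernel of a sequence of indiscernibles is the set of all \<open>d\<close> for which there is a \<open>p\<close> such
  that \<open>d\<close> is algebraic over any \<open>p\<close> members of the sequence: a formula witnessing algebraicity
  transfers along indiscernibility over \<open>d\<close>. Conversely, increasing tuples are joined by moves of one
  entry at a time, and the \<open>p\<close> members can be chosen away from the interval of the move. By the
  pigeonhole principle, the two tuples of such a move have the same type over elements that are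
  algebraic over the remaining entries and the \<open>p\<close> members, whence the sequence is indiscernible over
  all such \<open>d\<close> together.

  The \<open>p\<close> members may be restricted to an infinite part of the sequence. Applied to a concatenation
  this shows that the kernel of one part is algebraic over the other part. With \<open>p = 0\<close> it shows
  that indiscernibility over \<open>B\<close> implies indiscernibility over the algebraic closure of \<open>B\<close>; as each
  part is indiscernible over the other, this gives the reverse inclusion.\<close>


section \<open>Injective renaming of variables\<close>

text \<open>The definition of \<open>aker\<close> tests one element at a time, whereas (3) and (4)
  speak about many elements at once, and in general indiscernibility over several elements
  separately does not combine. Being algebraic over any \<open>p\<close> members does combine:
  finitely many elements share a common \<open>p\<close>, and a formula mentions only finitely many
  of them. No automorphisms are used and the sequence is never extended; the argument stays at the
  level of formulas, inside the given index order. An algebraic parameter is traded for a universal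
  quantifier over all solutions of a formula that leaves finitely many candidates for it. The
  resulting statement is over the base set, so it can be verified at a convenient place of the
  sequence and then carried to any other place. For this the number of candidates has to be bounded
  independently of the place.\<close>

definition ren_var :: "(nat \<Rightarrow> nat) \<Rightarrow> 's var \<Rightarrow> 's var" where
  "ren_var h v = (fst v, h (snd v))"

fun ren_tm :: "(nat \<Rightarrow> nat) \<Rightarrow> ('s, 'f) tm \<Rightarrow> ('s, 'f) tm" where
  "ren_tm h (Var v) = Var (ren_var h v)"
| "ren_tm h (App f ts) = App f (map (ren_tm h) ts)"

text \<open>Bound variables are renamed too, so an injective renaming cannot capture.\<close>

fun ren_fm :: "(nat \<Rightarrow> nat) \<Rightarrow> ('s, 'f, 'r) fm \<Rightarrow> ('s, 'f, 'r) fm" where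
  "ren_fm h (Eq t u) = Eq (ren_tm h t) (ren_tm h u)"
| "ren_fm h (Rel R ts) = Rel R (map (ren_tm h) ts)"
| "ren_fm h (Neg \<phi>) = Neg (ren_fm h \<phi>)"
| "ren_fm h (Conj \<phi> \<psi>) = Conj (ren_fm h \<phi>) (ren_fm h \<psi>)"
| "ren_fm h (Ex v \<phi>) = Ex (ren_var h v) (ren_fm h \<phi>)"

lemma inj_ren_var: "inj h \<Longrightarrow> inj (ren_var h)"
  by (auto simp: inj_def ren_var_def prod_eq_iff)

lemma tm_val_ren: "tm_val M e (ren_tm h t) = tm_val M (\<lambda>v. e (ren_var h v)) t"
  by (induction t) (auto simp: comp_def intro!: arg_cong[of _ _ "fun_int M _"])

lemma tm_sort_ren [simp]: "tm_sort L (ren_tm h t) = tm_sort L t"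
  by (cases t) (auto simp: ren_var_def)

lemma wf_tm_ren [simp]: "wf_tm L (ren_tm h t) = wf_tm L t"
  by (induction t) (auto simp: comp_def)

lemma vars_tm_ren: "vars_tm (ren_tm h t) = ren_var h ` vars_tm t"
  by (induction t) auto

lemma wf_fm_ren [simp]: "wf_fm L (ren_fm h \<phi>) = wf_fm L \<phi>"
  by (induction \<phi>) (auto simp: comp_def)

lemma fv_ren: "inj h \<Longrightarrow> fv (ren_fm h \<phi>) = ren_var h ` fv \<phi>"
  by (induction \<phi>) (auto simp: vars_tm_ren dest: injD[OF inj_ren_var])

lemma holds_ren:
  "inj h \<Longrightarrow> holds M e (ren_fm h \<phi>) \<longleftrightarrow> holds M (\<lambda>v. e (ren_var h v)) \<phi>"
proof (induction \<phi> arbitrary: e)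
  case (Ex v \<phi>)
  have "(\<lambda>u. (e(ren_var h v := d)) (ren_var h u)) = (\<lambda>u. e (ren_var h u))(v := d)" for d
    by (rule ext) (simp add: inj_eq[OF inj_ren_var[OF \<open>inj h\<close>]])
  then show ?case
    using Ex by (simp add: ren_var_def)
qed (auto simp: tm_val_ren comp_def)

lemma finite_vars_tm: "finite (vars_tm t)"
  by (induction t) simp_all

lemma finite_fv: "finite (fv \<phi>)"
  by (induction \<phi>) (simp_all add: finite_vars_tm)

lemma tm_val_cong: "(\<And>v. v \<in> vars_tm t \<Longrightarrow> e v = e' v) \<Longrightarrow> tm_val M e t = tm_val M e' t"
proof (induction t)
  case (App f ts)
  have "tm_val M e t = tm_val M e' t" if "t \<in> set ts" for t
    by (rule App.IH[OF that]) (rule App.prems, use that in \<open>force simp: vars_tm.simps\<close>)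
  then have "map (tm_val M e) ts = map (tm_val M e') ts"
    by simp
  then show ?case
    by (simp only: tm_val.simps)
qed simp

lemma holds_cong: "(\<And>v. v \<in> fv \<phi> \<Longrightarrow> e v = e' v) \<Longrightarrow> holds M e \<phi> \<longleftrightarrow> holds M e' \<phi>"
proof (induction \<phi> arbitrary: e e')
  case (Eq t u)
  have "tm_val M e t = tm_val M e' t" "tm_val M e u = tm_val M e' u"
    by (rule tm_val_cong, rule Eq.prems, simp)+
  then show ?case
    by simp
next
  case (Rel R ts)
  have "tm_val M e t = tm_val M e' t" if "t \<in> set ts" for t
    by (rule tm_val_cong) (rule Rel.prems, use that in \<open>force simp: fv.simps\<close>)
  then have "map (tm_val M e) ts = map (tm_val M e') ts"
    by simp
  then show ?case
    by (simp only: holds.simps)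
next
  case (Neg \<phi>)
  have "holds M e \<phi> \<longleftrightarrow> holds M e' \<phi>"
    by (rule Neg.IH, rule Neg.prems, simp)
  then show ?case
    by simp
next
  case (Conj \<phi> \<psi>)
  have "holds M e \<phi> \<longleftrightarrow> holds M e' \<phi>"
    by (rule Conj.IH(1), rule Conj.prems, simp)
  moreover have "holds M e \<psi> \<longleftrightarrow> holds M e' \<psi>"
    by (rule Conj.IH(2), rule Conj.prems, simp)
  ultimately show ?case
    by simp
next
  case (Ex v \<phi>)
  have "holds M (e(v := d)) \<phi> \<longleftrightarrow> holds M (e'(v := d)) \<phi>" for d
    by (rule Ex.IH) (simp add: Ex.prems)
  then show ?case
    by simp
qed


section \<open>Definable predicates on assignments\<close>

definition fits :: "('s, 'f, 'r, 'm) struct \<Rightarrow> 'x set \<Rightarrow> ('x \<Rightarrow> 's) \<Rightarrow> ('x \<Rightarrow> 'm) \<Rightarrow> bool" where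
  "fits M X \<sigma> p \<longleftrightarrow> (\<forall>x\<in>X. p x \<in> dom M (\<sigma> x))"

text \<open>A predicate on assignments stands in for a formula, so that later constructions can be
  written in HOL instead of syntax. Off the sort-correct assignments \<open>R\<close> is
  unconstrained; hence the \<open>fits\<close> hypotheses that recur below.\<close>

definition definable :: "('s, 'f, 'r) language \<Rightarrow> ('s, 'f, 'r, 'm) struct \<Rightarrow> 'm set \<Rightarrow>
    'x set \<Rightarrow> ('x \<Rightarrow> 's) \<Rightarrow> (('x \<Rightarrow> 'm) \<Rightarrow> bool) \<Rightarrow> bool" where
  "definable L M A X \<sigma> R \<longleftrightarrow>
     (\<exists>\<theta>\<in>pfms L M A X \<sigma>. \<forall>p. fits M X \<sigma> p \<longrightarrow> (R p \<longleftrightarrow> pholds M p \<theta>))"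

lemma pholds_cong:
  assumes "\<theta> \<in> pfms L M A X \<sigma>" and "\<And>x. x \<in> X \<Longrightarrow> p x = q x"
  shows "pholds M p \<theta> \<longleftrightarrow> pholds M q \<theta>"
proof -
  obtain \<phi> \<rho> where \<theta>: "\<theta> = (\<phi>, \<rho>)"
    by fastforce
  show ?thesis
    unfolding \<theta> pholds.simps
    by (rule holds_cong) (use assms in \<open>fastforce simp: \<theta> pfms_def split: sum.splits\<close>)
qed

lemma pfms_cong:
  "(\<And>x. x \<in> X \<Longrightarrow> \<sigma> x = \<tau> x) \<Longrightarrow> pfms L M A X \<sigma> = pfms L M A X \<tau>"
  unfolding pfms_def by (auto split: sum.splits)

lemma definable_pholds: "\<theta> \<in> pfms L M A X \<sigma> \<Longrightarrow> definable L M A X \<sigma> (\<lambda>p. pholds M p \<theta>)"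
  unfolding definable_def by blast

lemma definable_depends:
  assumes "definable L M A X \<sigma> R" "fits M X \<sigma> p" "\<And>x. x \<in> X \<Longrightarrow> p x = q x"
  shows "R p \<longleftrightarrow> R q"
proof -
  have "fits M X \<sigma> q"
    using assms(2,3) by (simp add: fits_def)
  then show ?thesis
    using assms unfolding definable_def by (metis pholds_cong)
qed

lemma definable_cong:
  assumes "definable L M A X \<sigma> R" "\<And>p. fits M X \<sigma> p \<Longrightarrow> R p \<longleftrightarrow> R' p"
  shows "definable L M A X \<sigma> R'"
  using assms unfolding definable_def by metis

section \<open>Boolean combinations and equality\<close>

lemma definable_neg:
  assumes "definable L M A X \<sigma> R"
  shows "definable L M A X \<sigma> (\<lambda>p. \<not> R p)"
proof -
  obtain \<phi> \<rho> where *: "(\<phi>, \<rho>) \<in> pfms L M A X \<sigma>"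
    "\<And>p. fits M X \<sigma> p \<Longrightarrow> R p \<longleftrightarrow> pholds M p (\<phi>, \<rho>)"
    using assms unfolding definable_def by auto
  from *(1) have "(Neg \<phi>, \<rho>) \<in> pfms L M A X \<sigma>"
    by (auto simp: pfms_def)
  then show ?thesis
    unfolding definable_def by (rule bexI[rotated]) (simp add: *(2))
qed

lemma definable_conj:
  fixes L :: "('s, 'f, 'r) language"
  assumes "definable L M A X \<sigma> R" "definable L M A X \<sigma> R'"
  shows "definable L M A X \<sigma> (\<lambda>p. R p \<and> R' p)"
proof -
  obtain \<phi> \<rho> where 1: "(\<phi>, \<rho>) \<in> pfms L M A X \<sigma>"
    "\<And>p. fits M X \<sigma> p \<Longrightarrow> R p \<longleftrightarrow> pholds M p (\<phi>, \<rho>)"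
    using assms(1) unfolding definable_def by auto
  obtain \<phi>' \<rho>' where 2: "(\<phi>', \<rho>') \<in> pfms L M A X \<sigma>"
    "\<And>p. fits M X \<sigma> p \<Longrightarrow> R' p \<longleftrightarrow> pholds M p (\<phi>', \<rho>')"
    using assms(2) unfolding definable_def by auto
  \<comment> \<open>The two formulas may use the same variable for different entries. Even and odd
    indices separate them, and \<open>\<rho>''\<close> decodes the parity.\<close>
  define h h' :: "nat \<Rightarrow> nat" where "h = (\<lambda>n. 2 * n)" and "h' = (\<lambda>n. 2 * n + 1)"
  have inj: "inj h" "inj h'"
    by (auto simp: inj_def h_def h'_def)
  define \<rho>'' where "\<rho>'' = (\<lambda>v :: 's var. if even (snd v) then \<rho> (fst v, snd v div 2)
    else \<rho>' (fst v, snd v div 2))"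
  have \<rho>'': "\<rho>'' (ren_var h v) = \<rho> v" "\<rho>'' (ren_var h' v) = \<rho>' v" for v
    by (auto simp: \<rho>''_def ren_var_def h_def h'_def)
  have fst_ren: "fst (ren_var k v) = fst v" for k :: "nat \<Rightarrow> nat" and v :: "'s var"
    by (simp add: ren_var_def)
  let ?\<theta> = "(Conj (ren_fm h \<phi>) (ren_fm h' \<phi>'), \<rho>'')"
  have "?\<theta> \<in> pfms L M A X \<sigma>"
    using 1(1) 2(1) by (simp add: pfms_def fv_ren inj ball_Un \<rho>'' fst_ren cong: sum.case_cong)
  moreover have "pholds M p ?\<theta> \<longleftrightarrow> pholds M p (\<phi>, \<rho>) \<and> pholds M p (\<phi>', \<rho>')" for p
    by (simp add: holds_ren inj \<rho>'')
  ultimately show ?thesis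
    unfolding definable_def using 1(2) 2(2) by blast
qed

lemma definable_imp:
  assumes "definable L M A X \<sigma> R" "definable L M A X \<sigma> R'"
  shows "definable L M A X \<sigma> (\<lambda>p. R p \<longrightarrow> R' p)"
  using definable_neg[OF definable_conj[OF assms(1) definable_neg[OF assms(2)]]] by simp

lemma definable_iff:
  assumes "definable L M A X \<sigma> R" "definable L M A X \<sigma> R'"
  shows "definable L M A X \<sigma> (\<lambda>p. R p \<longleftrightarrow> R' p)"
  by (rule definable_cong[OF definable_conj[OF definable_imp[OF assms]
        definable_imp[OF assms(2,1)]]]) blast

lemma definable_True:
  fixes L :: "('s, 'f, 'r) language"
  shows "definable L M A X \<sigma> (\<lambda>_. True)"
proof -
  let ?v = "(undefined, 0) :: 's var"
  let ?\<phi> = "Ex ?v (Eq (Var ?v) (Var ?v)) :: ('s, 'f, 'r) fm"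
  have *: "definable L M A X \<sigma> (\<lambda>p. pholds M p (?\<phi>, \<lambda>_. undefined))"
    by (rule definable_pholds) (auto simp: pfms_def)
  \<comment> \<open>A tautology built from \<open>?\<phi>\<close> avoids evaluating it: in the
    absence of \<open>is_struct\<close> a sort could be empty. \<open>?\<phi>\<close> is closed
    because \<open>X\<close> and \<open>A\<close> may be empty.\<close>
  have "definable L M A X \<sigma> (\<lambda>p. \<not> (pholds M p (?\<phi>, \<lambda>_. undefined) \<and>
     \<not> pholds M p (?\<phi>, \<lambda>_. undefined)))"
    by (intro definable_neg definable_conj *)
  then show ?thesis
    by simp
qed

lemma definable_ball:
  assumes "finite K" "\<And>k. k \<in> K \<Longrightarrow> definable L M A X \<sigma> (R k)"
  shows "definable L M A X \<sigma> (\<lambda>p. \<forall>k\<in>K. R k p)"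
  using assms
proof (induction K rule: finite_induct)
  case empty
  then show ?case
    by (simp add: definable_True)
next
  case (insert k K)
  then show ?case
    using definable_conj[of L M A X \<sigma> "R k" "\<lambda>p. \<forall>k\<in>K. R k p"] by simp
qed

lemma definable_eq:
  assumes "x \<in> X" "y \<in> X" "\<sigma> x = \<sigma> y"
  shows "definable L M A X \<sigma> (\<lambda>p. p x = p y)"
proof -
  let ?\<theta> = "(Eq (Var (\<sigma> x, 0)) (Var (\<sigma> x, 1)), \<lambda>v. Inl (if snd v = 0 then x else y))"
  have "definable L M A X \<sigma> (\<lambda>p. pholds M p ?\<theta>)"
    by (rule definable_pholds) (use assms in \<open>auto simp: pfms_def\<close>)
  then show ?thesis
    by simp
qed

section \<open>Substitution and change of parameters\<close>

lemma definable_subst: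
  assumes "definable L M A X \<sigma> R" "A \<subseteq> A'"
    and Inl: "\<And>x y. x \<in> X \<Longrightarrow> g x = Inl y \<Longrightarrow> y \<in> Y \<and> \<tau> y = \<sigma> x"
    and Inr: "\<And>x b. x \<in> X \<Longrightarrow> g x = Inr b \<Longrightarrow> b \<in> A' \<and> b \<in> dom M (\<sigma> x)"
  shows "definable L M A' Y \<tau> (\<lambda>p. R (\<lambda>x. case_sum p id (g x)))"
proof -
  obtain \<phi> \<rho> where 1: "(\<phi>, \<rho>) \<in> pfms L M A X \<sigma>"
    "\<And>p. fits M X \<sigma> p \<Longrightarrow> R p \<longleftrightarrow> pholds M p (\<phi>, \<rho>)"
    using assms(1) unfolding definable_def by auto
  let ?\<theta> = "(\<phi>, \<lambda>v. case_sum g Inr (\<rho> v))"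
  have "?\<theta> \<in> pfms L M A' Y \<tau>"
    using 1(1) assms(2)
    by (fastforce simp: pfms_def split: sum.splits dest: Inl Inr)
  moreover have "R (\<lambda>x. case_sum p id (g x)) \<longleftrightarrow> pholds M p ?\<theta>" if "fits M Y \<tau> p" for p
  proof -
    have "fits M X \<sigma> (\<lambda>x. case_sum p id (g x))"
      using that unfolding fits_def by (fastforce split: sum.splits dest: Inl Inr)
    then have "R (\<lambda>x. case_sum p id (g x)) \<longleftrightarrow> pholds M (\<lambda>x. case_sum p id (g x)) (\<phi>, \<rho>)"
      by (rule 1(2))
    also have "\<dots> \<longleftrightarrow> pholds M p ?\<theta>"
      unfolding pholds.simps by (rule holds_cong) (auto split: sum.splits)
    finally show ?thesis .
  qed
  ultimately show ?thesis
    unfolding definable_def by blast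
qed

lemma definable_reindex:
  assumes "definable L M A X \<sigma> R" "\<And>x. x \<in> X \<Longrightarrow> g x \<in> Y \<and> \<tau> (g x) = \<sigma> x"
  shows "definable L M A Y \<tau> (\<lambda>p. R (\<lambda>x. p (g x)))"
  using definable_subst[of L M A X \<sigma> R A "\<lambda>x. Inl (g x)" Y \<tau>] assms by auto

lemma definable_mono:
  assumes "definable L M A X \<sigma> R" "A \<subseteq> A'" "X \<subseteq> X'"
  shows "definable L M A' X' \<sigma> R"
  using definable_subst[of L M A X \<sigma> R A' Inl X' \<sigma>] assms by auto

text \<open>Frees the parameters in \<open>C\<close>, which become the values of \<open>q\<close> at
  variables from \<open>Y\<close>, so that other values can be tried in their place. A parameter
  that lies in \<open>A\<close> remains one.\<close>

lemma definable_parameters_to_variables: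
  fixes \<tau> :: "'y \<Rightarrow> 's" and R :: "('x \<Rightarrow> 'm) \<Rightarrow> bool"
  assumes "definable L M (A \<union> C) X \<sigma> R" "is_struct L M" "fits M Y \<tau> q" "C \<subseteq> q ` Y"
  obtains R' where "definable L M A (Inl ` X \<union> Inr ` Y) (case_sum \<sigma> \<tau>) R'"
    and "\<And>p. fits M X \<sigma> p \<Longrightarrow> R' (case_sum p q) \<longleftrightarrow> R p"
proof -
  obtain \<phi> \<rho> where 1: "(\<phi>, \<rho>) \<in> pfms L M (A \<union> C) X \<sigma>"
    "\<And>p. fits M X \<sigma> p \<Longrightarrow> R p \<longleftrightarrow> pholds M p (\<phi>, \<rho>)"
    using assms(1) unfolding definable_def by auto
  define h where "h = (\<lambda>c. SOME y. y \<in> Y \<and> q y = c)"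
  have h: "h c \<in> Y \<and> q (h c) = c" if "c \<in> C" for c
    unfolding h_def by (rule someI_ex) (use assms(4) that in blast)
  have disj: "s = t" if "d \<in> dom M s" "d \<in> dom M t" for d s t
    using assms(2) that unfolding is_struct_def by blast
  define \<rho>' where
    "\<rho>' = (\<lambda>v. case \<rho> v of Inl x \<Rightarrow> Inl (Inl x) | Inr b \<Rightarrow> if b \<in> A then Inr b else Inl (Inr (h b)))"
  have "(\<phi>, \<rho>') \<in> pfms L M A (Inl ` X \<union> Inr ` Y) (case_sum \<sigma> \<tau>)"
  proof -
    have "case \<rho>' v of Inl x \<Rightarrow> x \<in> Inl ` X \<union> Inr ` Y \<and> case_sum \<sigma> \<tau> x = fst v
           | Inr b \<Rightarrow> b \<in> A \<and> b \<in> dom M (fst v)" if "v \<in> fv \<phi>" for v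
    proof (cases "\<rho> v")
      case (Inl x)
      then show ?thesis
        using 1(1) that by (auto simp: \<rho>'_def pfms_def)
    next
      case (Inr b)
      then have b: "b \<in> A \<union> C" "b \<in> dom M (fst v)"
        using 1(1) that by (force simp: pfms_def)+
      show ?thesis
      proof (cases "b \<in> A")
        case False
        then have hb: "h b \<in> Y" "q (h b) = b"
          using b h by auto
        \<comment> \<open>\<open>b\<close> has the sort of the variable it is substituted for and
          also the sort of \<open>h b\<close>; by disjointness of sorts the two coincide.\<close>
        then have "b \<in> dom M (\<tau> (h b))"
          using assms(3) by (metis fits_def)
        then show ?thesis
          using False Inr b hb disj by (auto simp: \<rho>'_def)
      qed (use Inr b in \<open>auto simp: \<rho>'_def\<close>)
    qed
    then show ?thesis
      using 1(1) by (simp add: pfms_def)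
  qed
  moreover have "pholds M (case_sum p q) (\<phi>, \<rho>') \<longleftrightarrow> R p" if "fits M X \<sigma> p" for p
  proof -
    have "(case \<rho>' v of Inl x \<Rightarrow> case_sum p q x | Inr b \<Rightarrow> b) =
      (case \<rho> v of Inl x \<Rightarrow> p x | Inr b \<Rightarrow> b)" if "v \<in> fv \<phi>" for v
    proof (cases "\<rho> v")
      case (Inr b)
      then have "b \<in> A \<union> C"
        using 1(1) that by (force simp: pfms_def)
      then show ?thesis
        using Inr h by (auto simp: \<rho>'_def)
    qed (simp add: \<rho>'_def)
    then show ?thesis
      unfolding 1(2)[OF that] pholds.simps by (rule holds_cong)
  qed
  ultimately show thesis
    using that definable_pholds by blast
qed

lemma definable_finite_parameters:
  assumes "definable L M A X \<sigma> R"
  obtains A0 where "finite A0" "A0 \<subseteq> A" "definable L M A0 X \<sigma> R"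
proof -
  obtain \<phi> \<rho> where 1: "(\<phi>, \<rho>) \<in> pfms L M A X \<sigma>"
    "\<And>p. fits M X \<sigma> p \<Longrightarrow> R p \<longleftrightarrow> pholds M p (\<phi>, \<rho>)"
    using assms(1) unfolding definable_def by auto
  define A0 where "A0 = {b. \<exists>v\<in>fv \<phi>. \<rho> v = Inr b}"
  have "A0 \<subseteq> projr ` \<rho> ` fv \<phi>"
    unfolding A0_def by force
  then have "finite A0"
    using finite_fv finite_surj by (metis image_comp)
  moreover have "A0 \<subseteq> A"
    using 1(1) by (force simp: A0_def pfms_def)
  moreover have "(\<phi>, \<rho>) \<in> pfms L M A0 X \<sigma>"
    using 1(1) unfolding pfms_def A0_def by (auto split: sum.splits)
  ultimately show thesis
    using that 1(2) unfolding definable_def by blast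
qed

section \<open>Quantifiers and counting\<close>

lemma definable_ex_pholds:
  assumes "is_struct L M" "(\<phi>, \<rho>) \<in> pfms L M A (insert x X) \<sigma>" "x \<notin> X"
  shows "definable L M A X \<sigma> (\<lambda>p. \<exists>d\<in>dom M (\<sigma> x). pholds M (p(x := d)) (\<phi>, \<rho>))"
  using assms(2)
\<comment> \<open>\<open>\<rho>\<close> may send several variables of \<open>\<phi>\<close> to
  \<open>x\<close>, while \<open>Ex\<close> binds only one; hence the induction on their
  number.\<close>
proof (induction "card {v \<in> fv \<phi>. \<rho> v = Inl x}" arbitrary: \<phi> rule: less_induct)
  case less
  let ?V = "{v \<in> fv \<phi>. \<rho> v = Inl x}"
  have fin: "finite ?V"
    by (rule finite_subset[OF _ finite_fv[of \<phi>]]) auto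
  have sort: "fst v = \<sigma> x" if "v \<in> ?V" for v
    using less.prems that by (force simp: pfms_def)
  have other: "\<rho> v = Inl y \<Longrightarrow> y \<in> X" if "v \<in> fv \<phi> - ?V" for v y
    using less.prems that by (force simp: pfms_def)
  have val: "(case \<rho> u of Inl y \<Rightarrow> (p(x := d)) y | Inr b \<Rightarrow> b) =
    (case \<rho> u of Inl y \<Rightarrow> p y | Inr b \<Rightarrow> b)" if "u \<in> fv \<phi> - ?V" for u p d
    using that by (auto split: sum.splits)
  consider "?V = {}" | v where "?V = {v}" | v v' where "v \<in> ?V" "v' \<in> ?V" "v \<noteq> v'"
    by blast
  then show ?case
  proof cases
    case 1
    have "(\<phi>, \<rho>) \<in> pfms L M A X \<sigma>"
      using less.prems 1 by (fastforce simp: pfms_def split: sum.splits)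
    then have "definable L M A X \<sigma> (\<lambda>p. pholds M p (\<phi>, \<rho>))"
      by (rule definable_pholds)
    moreover have "pholds M (p(x := d)) (\<phi>, \<rho>) \<longleftrightarrow> pholds M p (\<phi>, \<rho>)" for p d
      unfolding pholds.simps by (rule holds_cong, rule val) (use 1 in auto)
    moreover have "dom M (\<sigma> x) \<noteq> {}"
      using assms(1) by (simp add: is_struct_def)
    ultimately show ?thesis
      by (elim definable_cong) auto
  next
    case (2 v)
    then have v: "\<rho> v = Inl x"
      by blast
    have "(Ex v \<phi>, \<rho>) \<in> pfms L M A X \<sigma>"
      using less.prems 2 by (fastforce simp: pfms_def split: sum.splits)
    then have "definable L M A X \<sigma> (\<lambda>p. pholds M p (Ex v \<phi>, \<rho>))"
      by (rule definable_pholds)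
    moreover have "holds M ((\<lambda>u. case \<rho> u of Inl y \<Rightarrow> p y | Inr b \<Rightarrow> b)(v := d)) \<phi>
      \<longleftrightarrow> pholds M (p(x := d)) (\<phi>, \<rho>)" for p d
      unfolding pholds.simps
    proof (rule holds_cong)
      fix u
      assume "u \<in> fv \<phi>"
      then show "((\<lambda>u. case \<rho> u of Inl y \<Rightarrow> p y | Inr b \<Rightarrow> b)(v := d)) u =
        (case \<rho> u of Inl y \<Rightarrow> (p(x := d)) y | Inr b \<Rightarrow> b)"
        using 2 v val[of u p d] by (cases "u = v") auto
    qed
    ultimately show ?thesis
      using sort[of v] 2 by (elim definable_cong) auto
  next
    case (3 v v')
    \<comment> \<open>Forcing \<open>v\<close> to equal \<open>v'\<close> and binding it removes one
      of the variables that stand for \<open>x\<close>; the occurrence of \<open>v'\<close> keeps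
      the value of \<open>x\<close>.\<close>
    let ?\<phi> = "Ex v (Conj (Eq (Var v) (Var v')) \<phi>)"
    have "(?\<phi>, \<rho>) \<in> pfms L M A (insert x X) \<sigma>"
      using less.prems 3 sort[of v] sort[of v'] by (auto simp: pfms_def)
    moreover have "{u \<in> fv ?\<phi>. \<rho> u = Inl x} \<subset> ?V"
      using 3 by auto
    then have "card {u \<in> fv ?\<phi>. \<rho> u = Inl x} < card ?V"
      using fin psubset_card_mono by blast
    ultimately have "definable L M A X \<sigma> (\<lambda>p. \<exists>d\<in>dom M (\<sigma> x). pholds M (p(x := d)) (?\<phi>, \<rho>))"
      by (intro less.hyps)
    moreover have "pholds M (p(x := d)) (?\<phi>, \<rho>) \<longleftrightarrow> pholds M (p(x := d)) (\<phi>, \<rho>)"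
      if "d \<in> dom M (\<sigma> x)" for p d
    proof -
      let ?e = "\<lambda>u. case \<rho> u of Inl y \<Rightarrow> (p(x := d)) y | Inr b \<Rightarrow> b"
      have "?e v = d" "?e v' = d" "?e(v := d) = ?e"
        using 3 by auto
      then show ?thesis
        using 3 that sort[of v] by auto
    qed
    ultimately show ?thesis
      by (elim definable_cong) auto
  qed
qed

lemma definable_ex:
  assumes "is_struct L M" "definable L M A (insert x X) \<sigma> R" "x \<notin> X"
  shows "definable L M A X \<sigma> (\<lambda>p. \<exists>d\<in>dom M (\<sigma> x). R (p(x := d)))"
proof -
  obtain \<phi> \<rho> where 1: "(\<phi>, \<rho>) \<in> pfms L M A (insert x X) \<sigma>"
    "\<And>p. fits M (insert x X) \<sigma> p \<Longrightarrow> R p \<longleftrightarrow> pholds M p (\<phi>, \<rho>)"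
    using assms(2) unfolding definable_def by auto
  have "R (p(x := d)) \<longleftrightarrow> pholds M (p(x := d)) (\<phi>, \<rho>)"
    if "fits M X \<sigma> p" "d \<in> dom M (\<sigma> x)" for p d
    by (rule 1(2)) (use that in \<open>auto simp: fits_def\<close>)
  then show ?thesis
    by (intro definable_cong[OF definable_ex_pholds[OF assms(1) 1(1) assms(3)]]) auto
qed

lemma definable_ex_finite:
  assumes "is_struct L M" "finite E" "definable L M A (E \<union> X) \<sigma> R" "E \<inter> X = {}"
  shows "definable L M A X \<sigma>
    (\<lambda>p. \<exists>q. fits M E \<sigma> q \<and> (\<forall>x. x \<notin> E \<longrightarrow> q x = p x) \<and> R q)"
  using assms(2-)
proof (induction E arbitrary: X rule: finite_induct)
  case empty
  moreover have "(\<exists>q. fits M {} \<sigma> q \<and> (\<forall>x. x \<notin> {} \<longrightarrow> q x = p x) \<and> R q) \<longleftrightarrow> R p" for p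
  proof -
    have "(\<forall>x. q x = p x) \<longleftrightarrow> q = p" for q
      by auto
    then show ?thesis
      by (simp add: fits_def)
  qed
  ultimately show ?case
    by simp
next
  case (insert e E)
  have "definable L M A (insert e X) \<sigma>
    (\<lambda>p. \<exists>q. fits M E \<sigma> q \<and> (\<forall>x. x \<notin> E \<longrightarrow> q x = p x) \<and> R q)"
    by (rule insert.IH) (use insert in auto)
  then have "definable L M A X \<sigma> (\<lambda>p. \<exists>d\<in>dom M (\<sigma> e).
    \<exists>q. fits M E \<sigma> q \<and> (\<forall>x. x \<notin> E \<longrightarrow> q x = (p(e := d)) x) \<and> R q)"
    by (rule definable_ex[OF assms(1)]) (use insert in auto)
  then show ?case
  proof (rule definable_cong)
    fix p
    show "(\<exists>d\<in>dom M (\<sigma> e).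
        \<exists>q. fits M E \<sigma> q \<and> (\<forall>x. x \<notin> E \<longrightarrow> q x = (p(e := d)) x) \<and> R q) \<longleftrightarrow>
      (\<exists>q. fits M (insert e E) \<sigma> q \<and> (\<forall>x. x \<notin> insert e E \<longrightarrow> q x = p x) \<and> R q)"
      (is "?l \<longleftrightarrow> ?r")
    proof
      assume ?l
      then obtain d q where *: "d \<in> dom M (\<sigma> e)" "fits M E \<sigma> q"
        "\<forall>x. x \<notin> E \<longrightarrow> q x = (p(e := d)) x" "R q"
        by blast
      then have "q e = d"
        using insert by auto
      then show ?r
        using * by (intro exI[of _ q]) (auto simp: fits_def)
    next
      assume ?r
      then obtain q where *: "fits M (insert e E) \<sigma> q" "\<forall>x. x \<notin> insert e E \<longrightarrow> q x = p x" "R q"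
        by blast
      then show ?l
        by (intro bexI[of _ "q e"] exI[of _ q]) (auto simp: fits_def)
    qed
  qed
qed

text \<open>The sum type keeps the quantified block \<open>E\<close> apart from the free variables
  \<open>X\<close>, whatever their index types.\<close>

lemma definable_ex_sum:
  assumes "is_struct L M" "finite E" "definable L M A (Inl ` X \<union> Inr ` E) (case_sum \<sigma> \<tau>) R"
  shows "definable L M A X \<sigma> (\<lambda>p. \<exists>d. fits M E \<tau> d \<and> R (case_sum p d))"
proof -
  let ?E = "Inr ` E" and ?\<sigma> = "case_sum \<sigma> \<tau>"
  have "definable L M A (Inl ` X) ?\<sigma>
     (\<lambda>p. \<exists>q. fits M ?E ?\<sigma> q \<and> (\<forall>x. x \<notin> ?E \<longrightarrow> q x = p x) \<and> R q)"
    by (rule definable_ex_finite) (use assms in \<open>auto simp: Un_commute\<close>)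
  then have "definable L M A X \<sigma>
     (\<lambda>p. \<exists>q. fits M ?E ?\<sigma> q \<and> (\<forall>x. x \<notin> ?E \<longrightarrow> q x = p (projl x)) \<and> R q)"
    by (rule definable_reindex) auto
  then show ?thesis
  proof (rule definable_cong)
    fix p
    assume p: "fits M X \<sigma> p"
    show "(\<exists>q. fits M ?E ?\<sigma> q \<and> (\<forall>x. x \<notin> ?E \<longrightarrow> q x = p (projl x)) \<and> R q) \<longleftrightarrow>
      (\<exists>d. fits M E \<tau> d \<and> R (case_sum p d))" (is "?l \<longleftrightarrow> ?r")
    proof
      assume ?l
      then obtain q where q: "fits M ?E ?\<sigma> q" "\<forall>x. x \<notin> ?E \<longrightarrow> q x = p (projl x)" "R q"
        by blast
      then have "\<forall>x. q (Inl x) = p x"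
        by auto
      with p q have "R q \<longleftrightarrow> R (case_sum p (\<lambda>e. q (Inr e)))"
        by (intro definable_depends[OF assms(3)]) (auto simp: fits_def)
      then show ?r
        using q by (intro exI[of _ "\<lambda>e. q (Inr e)"]) (auto simp: fits_def)
    next
      assume ?r
      then obtain d where d: "fits M E \<tau> d" "R (case_sum p d)"
        by blast
      define q where "q = (\<lambda>x. if x \<in> ?E then d (projr x) else p (projl x))"
      have "fits M (Inl ` X \<union> ?E) ?\<sigma> q"
        using p d by (auto simp: fits_def q_def)
      then have "R q \<longleftrightarrow> R (case_sum p d)"
        by (rule definable_depends[OF assms(3)]) (auto simp: q_def)
      then show ?l
        using d by (intro exI[of _ q]) (auto simp: fits_def q_def)
    qed
  qed
qed

lemma definable_all_sum:
  assumes "is_struct L M" "finite E" "definable L M A (Inl ` X \<union> Inr ` E) (case_sum \<sigma> \<tau>) R"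
  shows "definable L M A X \<sigma> (\<lambda>p. \<forall>d. fits M E \<tau> d \<longrightarrow> R (case_sum p d))"
  by (rule definable_cong[OF definable_neg[OF definable_ex_sum[OF assms(1,2)
          definable_neg[OF assms(3)]]]]) blast

text \<open>Expresses a cardinality bound through a fixed finite number of elements, which a formula
  can quantify over. The negated form also covers infinite \<open>D\<close>.\<close>

lemma card_gt_iff_inj:
  "\<not> (finite D \<and> card D \<le> m) \<longleftrightarrow> (\<exists>f :: nat \<Rightarrow> 'a. inj_on f {..m} \<and> f ` {..m} \<subseteq> D)"
proof
  assume "\<not> (finite D \<and> card D \<le> m)"
  then obtain D' where "D' \<subseteq> D" "finite D'" "card D' = Suc m"
    by (metis infinite_arbitrarily_large not_less_eq_eq obtain_subset_with_card_n)
  then obtain f where "bij_betw f {..<Suc m} D'"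
    using ex_bij_betw_nat_finite[of D'] by (auto simp: atLeast0LessThan)
  then show "\<exists>f :: nat \<Rightarrow> 'a. inj_on f {..m} \<and> f ` {..m} \<subseteq> D"
    using \<open>D' \<subseteq> D\<close> by (auto simp: bij_betw_def lessThan_Suc_atMost)
next
  assume "\<exists>f :: nat \<Rightarrow> 'a. inj_on f {..m} \<and> f ` {..m} \<subseteq> D"
  then show "\<not> (finite D \<and> card D \<le> m)"
    by (metis card_inj_on_le card_atMost not_less_eq_eq)
qed

text \<open>The formula says that no \<open>m + 1\<close> distinct elements satisfy \<open>R\<close>.\<close>

lemma definable_card_le:
  fixes R :: "('x \<Rightarrow> 'm) \<Rightarrow> bool"
  assumes "is_struct L M" "definable L M A (insert x X) \<sigma> R" "x \<notin> X"
  shows "definable L M A X \<sigma>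
    (\<lambda>p. finite {c \<in> dom M (\<sigma> x). R (p(x := c))} \<and> card {c \<in> dom M (\<sigma> x). R (p(x := c))} \<le> m)"
proof -
  define Q where "Q = (\<lambda>q :: 'x + nat \<Rightarrow> 'm.
    (\<forall>i\<in>{..m}. R (\<lambda>y. q (if y = x then Inr i else Inl y))) \<and>
    (\<forall>i\<in>{..m}. \<forall>j\<in>{..m}-{i}. \<not> q (Inr i) = q (Inr j)))"
  have "definable L M A (Inl ` X \<union> Inr ` {..m}) (case_sum \<sigma> (\<lambda>_. \<sigma> x)) Q"
    unfolding Q_def
    by (intro definable_conj definable_ball definable_neg definable_eq
        definable_reindex[OF assms(2)]) auto
  then have "definable L M A X \<sigma>
     (\<lambda>p. \<not> (\<exists>d. fits M {..m} (\<lambda>_. \<sigma> x) d \<and> Q (case_sum p d)))"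
    by (intro definable_neg definable_ex_sum assms(1)) auto
  moreover have "Q (case_sum p d) \<longleftrightarrow> (\<forall>i\<in>{..m}. R (p(x := d i))) \<and> inj_on d {..m}" for p d
  proof -
    have "(\<lambda>y. case_sum p d (if y = x then Inr i else Inl y)) = p(x := d i)" for i
      by auto
    then show ?thesis
      by (auto simp: Q_def inj_on_def)
  qed
  moreover have "(\<exists>d. fits M {..m} (\<lambda>_. \<sigma> x) d \<and> (\<forall>i\<in>{..m}. R (p(x := d i))) \<and> inj_on d {..m})
    \<longleftrightarrow> \<not> (finite {c \<in> dom M (\<sigma> x). R (p(x := c))} \<and>
      card {c \<in> dom M (\<sigma> x). R (p(x := c))} \<le> m)" for p
    unfolding card_gt_iff_inj by (auto simp: fits_def)
  ultimately show ?thesis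
    by simp
qed


section \<open>Algebraic closure\<close>

lemma sort_of_eq: "is_struct L M \<Longrightarrow> d \<in> dom M s \<Longrightarrow> sort_of M d = s"
  unfolding is_struct_def sort_of_def by (intro the_equality) auto

lemma in_dom_sort_of: "is_struct L M \<Longrightarrow> d \<in> univ M \<Longrightarrow> d \<in> dom M (sort_of M d)"
  unfolding univ_def using sort_of_eq by fastforce

lemma acl_iff:
  assumes "is_struct L M" "d \<in> dom M s"
  shows "d \<in> acl L M A \<longleftrightarrow> (\<exists>R. definable L M A {()} (\<lambda>_. s) R \<and> R (\<lambda>_. d) \<and>
    finite {c \<in> dom M s. R (\<lambda>_. c)})" (is "_ \<longleftrightarrow> ?r")
proof -
  have acl_eq: "d \<in> acl L M A \<longleftrightarrow> (\<exists>\<theta>\<in>pfms L M A {()} (\<lambda>_. s).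
      pholds M (\<lambda>_. d) \<theta> \<and> finite {c \<in> dom M s. pholds M (\<lambda>_. c) \<theta>})"
    using assms sort_of_eq[OF assms] by (auto simp: acl_def univ_def)
  have fits: "fits M {()} (\<lambda>_. s) (\<lambda>_. c) \<longleftrightarrow> c \<in> dom M s" for c
    by (simp add: fits_def)
  show ?thesis
  proof
    assume "d \<in> acl L M A"
    then obtain \<theta> where "\<theta> \<in> pfms L M A {()} (\<lambda>_. s)" "pholds M (\<lambda>_. d) \<theta>"
      "finite {c \<in> dom M s. pholds M (\<lambda>_. c) \<theta>}"
      unfolding acl_eq by (elim bexE conjE)
    then show ?r
      by (intro exI[of _ "\<lambda>p. pholds M p \<theta>"] conjI definable_pholds)
  next
    assume ?r
    then obtain R where R: "definable L M A {()} (\<lambda>_. s) R" "R (\<lambda>_. d)"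
      "finite {c \<in> dom M s. R (\<lambda>_. c)}"
      by (elim exE conjE)
    then obtain \<theta> where \<theta>: "\<theta> \<in> pfms L M A {()} (\<lambda>_. s)"
      "\<And>p. fits M {()} (\<lambda>_. s) p \<Longrightarrow> R p \<longleftrightarrow> pholds M p \<theta>"
      unfolding definable_def by auto
    have *: "R (\<lambda>_. c) \<longleftrightarrow> pholds M (\<lambda>_. c) \<theta>" if "c \<in> dom M s" for c
      by (rule \<theta>(2)) (simp add: fits that)
    then have "{c \<in> dom M s. R (\<lambda>_. c)} = {c \<in> dom M s. pholds M (\<lambda>_. c) \<theta>}"
      by auto
    then show "d \<in> acl L M A"
      unfolding acl_eq using R \<theta>(1) *[OF assms(2)] by (intro bexI[of _ \<theta>]) simp_all
  qed
qed

lemma acl_subset_univ: "acl L M A \<subseteq> univ M"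
  by (auto simp: acl_def)

lemma acl_mono:
  assumes "A \<subseteq> B"
  shows "acl L M A \<subseteq> acl L M B"
proof -
  have "pfms L M A X \<sigma> \<subseteq> pfms L M B X \<sigma>" for X :: "unit set" and \<sigma>
    using assms unfolding pfms_def by (auto split: sum.splits)
  then show ?thesis
    unfolding acl_def by blast
qed

lemma subset_acl:
  assumes "is_struct L M" "A \<subseteq> univ M"
  shows "A \<subseteq> acl L M A"
proof
  fix d
  assume d: "d \<in> A"
  then have s: "d \<in> dom M (sort_of M d)"
    by (intro in_dom_sort_of[OF assms(1)] subsetD[OF assms(2)])
  let ?\<theta> = "(Eq (Var (sort_of M d, 0)) (Var (sort_of M d, 1)),
    \<lambda>v. if snd v = 0 then Inl () else Inr d)"
  have "definable L M A {()} (\<lambda>_. sort_of M d) (\<lambda>p. pholds M p ?\<theta>)"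
    by (rule definable_pholds) (use d s in \<open>simp add: pfms_def\<close>)
  then have "definable L M A {()} (\<lambda>_. sort_of M d) (\<lambda>p. p () = d)"
    by simp
  moreover have "finite {c \<in> dom M (sort_of M d). c = d}"
    by (rule finite_subset[of _ "{d}"]) auto
  ultimately show "d \<in> acl L M A"
    unfolding acl_iff[OF assms(1) s] by (intro exI[of _ "\<lambda>p. p () = d"]) simp
qed

lemma acl_finite_character:
  assumes "is_struct L M" "d \<in> acl L M A"
  obtains A0 where "finite A0" "A0 \<subseteq> A" "d \<in> acl L M A0"
proof -
  have s: "d \<in> dom M (sort_of M d)"
    by (rule in_dom_sort_of[OF assms(1) subsetD[OF acl_subset_univ assms(2)]])
  obtain R where R: "definable L M A {()} (\<lambda>_. sort_of M d) R" "R (\<lambda>_. d)"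
    "finite {c \<in> dom M (sort_of M d). R (\<lambda>_. c)}"
    using assms(2) unfolding acl_iff[OF assms(1) s] by blast
  obtain A0 where A0: "finite A0" "A0 \<subseteq> A" "definable L M A0 {()} (\<lambda>_. sort_of M d) R"
    using definable_finite_parameters[OF R(1)] .
  have "d \<in> acl L M A0"
    unfolding acl_iff[OF assms(1) s] using A0(3) R(2,3) by (intro exI[of _ R] conjI)
  with A0(1,2) show thesis
    by (rule that)
qed

text \<open>The bound \<open>m\<close> on the number of solutions is made part of the formula, so that it holds
  for all values of the parameters.\<close>

lemma acl_tupleE:
  assumes "is_struct L M" "d \<in> dom M s" "d \<in> acl L M (A \<union> C)" "fits M Y \<tau> q" "C \<subseteq> q ` Y"
  obtains R m where "definable L M A (Inl ` {()} \<union> Inr ` Y) (case_sum (\<lambda>_. s) \<tau>) R"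
    and "R (case_sum (\<lambda>_. d) q)"
    and "\<forall>q'. finite {c \<in> dom M s. R (case_sum (\<lambda>_. c) q')} \<and>
      card {c \<in> dom M s. R (case_sum (\<lambda>_. c) q')} \<le> m"
proof -
  obtain R0 where R0: "definable L M (A \<union> C) {()} (\<lambda>_. s) R0" "R0 (\<lambda>_. d)"
    "finite {c \<in> dom M s. R0 (\<lambda>_. c)}"
    using assms(3) acl_iff[OF assms(1,2)] by auto
  obtain R where R: "definable L M A (Inl ` {()} \<union> Inr ` Y) (case_sum (\<lambda>_. s) \<tau>) R"
    "\<And>p. fits M {()} (\<lambda>_. s) p \<Longrightarrow> R (case_sum p q) \<longleftrightarrow> R0 p"
    using definable_parameters_to_variables[OF R0(1) assms(1,4,5)] by auto
  have R': "R (case_sum (\<lambda>_. c) q) \<longleftrightarrow> R0 (\<lambda>_. c)" if "c \<in> dom M s" for c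
    using R(2) that by (simp add: fits_def)
  define m where "m = card {c \<in> dom M s. R0 (\<lambda>_. c)}"
  let ?D = "\<lambda>p. {c \<in> dom M s. R (p(Inl () := c))}"
  \<comment> \<open>The count clause does not depend on the entry at \<open>Inl ()\<close>, which
    \<open>?D\<close> overwrites. So for each tuple \<open>R1\<close> has either the solutions of
    \<open>R\<close>, at most \<open>m\<close> many, or none.\<close>
  define R1 where "R1 = (\<lambda>p. R p \<and> finite (?D p) \<and> card (?D p) \<le> m)"
  have "definable L M A (Inr ` Y) (case_sum (\<lambda>_. s) \<tau>) (\<lambda>p. finite (?D p) \<and> card (?D p) \<le> m)"
    using definable_card_le[OF assms(1), of A "Inl ()" "Inr ` Y" "case_sum (\<lambda>_. s) \<tau>" R m] R(1)
    by auto
  then have "definable L M A (Inl ` {()} \<union> Inr ` Y) (case_sum (\<lambda>_. s) \<tau>)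
      (\<lambda>p. finite (?D p) \<and> card (?D p) \<le> m)"
    by (rule definable_mono) auto
  then have R1: "definable L M A (Inl ` {()} \<union> Inr ` Y) (case_sum (\<lambda>_. s) \<tau>) R1"
    unfolding R1_def by (rule definable_conj[OF R(1)])
  have D: "?D (case_sum (\<lambda>_. c) q') = {c \<in> dom M s. R (case_sum (\<lambda>_. c) q')}" for c q'
  proof -
    have "(case_sum (\<lambda>_. c) q')(Inl () := c') = case_sum (\<lambda>_. c') q'" for c'
      by (auto simp: fun_eq_iff split: sum.splits)
    then show ?thesis
      by simp
  qed
  have "{c \<in> dom M s. R (case_sum (\<lambda>_. c) q)} = {c \<in> dom M s. R0 (\<lambda>_. c)}"
    using R' by blast
  then have R1_d: "R1 (case_sum (\<lambda>_. d) q)"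
    using R0 R' assms(2) by (simp add: R1_def D m_def)
  have "finite {c \<in> dom M s. R1 (case_sum (\<lambda>_. c) q')} \<and>
    card {c \<in> dom M s. R1 (case_sum (\<lambda>_. c) q')} \<le> m" for q'
  proof (cases "finite {c \<in> dom M s. R (case_sum (\<lambda>_. c) q')} \<and>
      card {c \<in> dom M s. R (case_sum (\<lambda>_. c) q')} \<le> m")
    case True
    then show ?thesis
      by (simp add: R1_def D)
  next
    case False
    then have "{c \<in> dom M s. R1 (case_sum (\<lambda>_. c) q')} = {}"
      by (auto simp: R1_def D)
    then show ?thesis
      by (simp only: finite.emptyI card.empty le0 simp_thms)
  qed
  then have "\<forall>q'. finite {c \<in> dom M s. R1 (case_sum (\<lambda>_. c) q')} \<and>
      card {c \<in> dom M s. R1 (case_sum (\<lambda>_. c) q')} \<le> m"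
    by (rule allI)
  with R1 R1_d show thesis
    by (rule that)
qed

text \<open>The passage back from variables to parameters: the entries of \<open>q\<close> are
  frozen, and finiteness is asked for this one tuple.\<close>

lemma acl_tupleI:
  assumes "is_struct L M" "d \<in> dom M s" "fits M Y \<tau> q" "A \<subseteq> B" "q ` Y \<subseteq> B"
    and "definable L M A (Inl ` {()} \<union> Inr ` Y) (case_sum (\<lambda>_. s) \<tau>) R"
    and "R (case_sum (\<lambda>_. d) q)" "finite {c \<in> dom M s. R (case_sum (\<lambda>_. c) q)}"
  shows "d \<in> acl L M B"
proof -
  have "definable L M B {()} (\<lambda>_. s)
    (\<lambda>p. R (\<lambda>x. case_sum p id (case_sum Inl (\<lambda>y. Inr (q y)) x)))"
    by (rule definable_subst[OF assms(6,4)]) (use assms(3,5) in \<open>auto simp: fits_def\<close>)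
  moreover have eq: "(\<lambda>x. case_sum p id (case_sum Inl (\<lambda>y. Inr (q y)) x)) = case_sum p q" for p
    by (auto simp: fun_eq_iff split: sum.splits)
  ultimately have "definable L M B {()} (\<lambda>_. s) (\<lambda>p. R (case_sum p q))"
    by (elim definable_cong) (rule arg_cong[of _ _ R], rule eq)
  then show ?thesis
    unfolding acl_iff[OF assms(1,2)] using assms(7,8)
    by (intro exI[of _ "\<lambda>p. R (case_sum p q)"] conjI)
qed

text \<open>In a witness for \<open>d\<close>, the finitely many algebraic parameters
  \<open>E\<close> are replaced by existentially quantified solutions of their own witnesses
  \<open>P\<close>. Finitely many such tuples exist, and the bound built into \<open>R\<close> makes
  every one of them, not only the original one, contribute finitely many values.\<close>

lemma acl_idem:
  assumes "is_struct L M"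
  shows "acl L M (acl L M A) \<subseteq> acl L M A"
proof
  fix d
  assume d: "d \<in> acl L M (acl L M A)"
  then obtain E where E: "finite E" "E \<subseteq> acl L M A" "d \<in> acl L M E"
    by (rule acl_finite_character[OF assms])
  have s: "d \<in> dom M (sort_of M d)"
    by (rule in_dom_sort_of[OF assms subsetD[OF acl_subset_univ d]])
  have sE: "e \<in> dom M (sort_of M e)" if "e \<in> E" for e
    using in_dom_sort_of[OF assms subsetD[OF acl_subset_univ subsetD[OF E(2) that]]] .
  have dE: "d \<in> acl L M ({} \<union> E)" and fits_id: "fits M E (sort_of M) id" and "E \<subseteq> id ` E"
    using E(3) sE by (simp_all add: fits_def)
  obtain R m where
    R: "definable L M {} (Inl ` {()} \<union> Inr ` E) (case_sum (\<lambda>_. sort_of M d) (sort_of M)) R"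
      "R (case_sum (\<lambda>_. d) id)"
      "\<forall>q. finite {c \<in> dom M (sort_of M d). R (case_sum (\<lambda>_. c) q)} \<and>
        card {c \<in> dom M (sort_of M d). R (case_sum (\<lambda>_. c) q)} \<le> m"
    using acl_tupleE[OF assms s dE fits_id \<open>E \<subseteq> id ` E\<close>] .
  have "\<forall>e\<in>E. \<exists>P. definable L M A {()} (\<lambda>_. sort_of M e) P \<and> P (\<lambda>_. e) \<and>
    finite {c \<in> dom M (sort_of M e). P (\<lambda>_. c)}"
  proof
    fix e
    assume "e \<in> E"
    then show "\<exists>P. definable L M A {()} (\<lambda>_. sort_of M e) P \<and> P (\<lambda>_. e) \<and>
      finite {c \<in> dom M (sort_of M e). P (\<lambda>_. c)}"
      using E(2) by (subst acl_iff[OF assms sE, symmetric]) auto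
  qed
  from bchoice[OF this] obtain P where "\<forall>e\<in>E. definable L M A {()} (\<lambda>_. sort_of M e) (P e) \<and>
    P e (\<lambda>_. e) \<and> finite {c \<in> dom M (sort_of M e). P e (\<lambda>_. c)}" ..
  then have P: "\<And>e. e \<in> E \<Longrightarrow> definable L M A {()} (\<lambda>_. sort_of M e) (P e)"
    "\<And>e. e \<in> E \<Longrightarrow> P e (\<lambda>_. e)" "\<And>e. e \<in> E \<Longrightarrow> finite {c \<in> dom M (sort_of M e). P e (\<lambda>_. c)}"
    by simp_all
  define R' where "R' = (\<lambda>p. R p \<and> (\<forall>e\<in>E. P e (\<lambda>_. p (Inr e))))"
  have "definable L M A (Inl ` {()} \<union> Inr ` E) (case_sum (\<lambda>_. sort_of M d) (sort_of M)) R'"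
    unfolding R'_def
    by (intro definable_conj definable_ball E(1) definable_mono[OF R(1)] definable_reindex[OF P(1)])
      simp_all
  then have "definable L M A {()} (\<lambda>_. sort_of M d)
    (\<lambda>p. \<exists>q. fits M E (sort_of M) q \<and> R' (case_sum p q))"
    by (rule definable_ex_sum[OF assms E(1)])
  moreover have "\<exists>q. fits M E (sort_of M) q \<and> R' (case_sum (\<lambda>_. d) q)"
    using R(2) P(2) fits_id by (intro exI[of _ id]) (simp add: R'_def)
  moreover have "finite {c \<in> dom M (sort_of M d).
    \<exists>q. fits M E (sort_of M) q \<and> R' (case_sum (\<lambda>_. c) q)}" (is "finite ?D")
  proof (rule finite_subset)
    let ?\<Pi> = "PiE E (\<lambda>e. {c \<in> dom M (sort_of M e). P e (\<lambda>_. c)})"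
    show "finite (\<Union>q\<in>?\<Pi>. {c \<in> dom M (sort_of M d). R (case_sum (\<lambda>_. c) q)})"
      by (intro finite_UN_I finite_PiE E(1) P(3) conjunct1[OF spec[OF R(3)]])
    show "?D \<subseteq> (\<Union>q\<in>?\<Pi>. {c \<in> dom M (sort_of M d). R (case_sum (\<lambda>_. c) q)})"
    proof
      fix c
      assume "c \<in> ?D"
      then obtain q where q: "c \<in> dom M (sort_of M d)" "fits M E (sort_of M) q"
        "R (case_sum (\<lambda>_. c) q)" "\<forall>e\<in>E. P e (\<lambda>_. q e)"
        by (auto simp: R'_def)
      \<comment> \<open>\<open>PiE\<close> consists of extensional functions, so \<open>q\<close> is
        cut down to \<open>E\<close>, outside of which \<open>R\<close> does not see it.\<close>
      have "R (case_sum (\<lambda>_. c) q) \<longleftrightarrow> R (case_sum (\<lambda>_. c) (restrict q E))"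
        by (rule definable_depends[OF R(1)]) (use q in \<open>auto simp: fits_def\<close>)
      moreover have "restrict q E \<in> ?\<Pi>"
        using q by (auto simp: fits_def)
      ultimately show "c \<in> (\<Union>q\<in>?\<Pi>. {c \<in> dom M (sort_of M d). R (case_sum (\<lambda>_. c) q)})"
        using q by blast
    qed
  qed
  ultimately show "d \<in> acl L M A"
    unfolding acl_iff[OF assms s]
    by (intro exI[of _ "\<lambda>p. \<exists>q. fits M E (sort_of M) q \<and> R' (case_sum p q)"] conjI)
qed


section \<open>Increasing lists\<close>

abbreviation strictly :: "'i rel \<Rightarrow> 'i \<Rightarrow> 'i \<Rightarrow> bool" where
  "strictly r i j \<equiv> (i, j) \<in> r \<and> i \<noteq> j"

lemma increasing_Nil [simp]: "increasing r []"
  by (simp add: increasing_def)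

lemma increasing_Cons: "increasing r (x # xs) \<longleftrightarrow>
    x \<in> Field r \<and> (\<forall>y\<in>set xs. strictly r x y) \<and> increasing r xs"
  by (auto simp: increasing_def)

lemma increasing_append: "increasing r (xs @ ys) \<longleftrightarrow>
    increasing r xs \<and> increasing r ys \<and> (\<forall>x\<in>set xs. \<forall>y\<in>set ys. strictly r x y)"
  by (auto simp: increasing_def sorted_wrt_append)

lemma increasing_nth:
  "increasing r ks \<Longrightarrow> i < j \<Longrightarrow> j < length ks \<Longrightarrow> strictly r (ks ! i) (ks ! j)"
  by (simp add: increasing_def sorted_wrt_iff_nth_less)

lemma increasing_set: "increasing r ks \<Longrightarrow> set ks \<subseteq> Field r"
  by (simp add: increasing_def)

lemma increasing_distinct: "increasing r ks \<Longrightarrow> distinct ks"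
  by (induction ks) (auto simp: increasing_Cons)

lemma linear_order_total:
  "Linear_order r \<Longrightarrow> i \<in> Field r \<Longrightarrow> j \<in> Field r \<Longrightarrow> i \<noteq> j \<Longrightarrow> strictly r i j \<or> strictly r j i"
  unfolding order_on_defs total_on_def by blast

lemma linear_order_trans:
  "Linear_order r \<Longrightarrow> (i, j) \<in> r \<Longrightarrow> (j, k) \<in> r \<Longrightarrow> (i, k) \<in> r"
  unfolding order_on_defs by (meson transD)

lemma linear_order_antisym: "Linear_order r \<Longrightarrow> (i, j) \<in> r \<Longrightarrow> (j, i) \<in> r \<Longrightarrow> i = j"
  unfolding order_on_defs by (meson antisymD)

lemma linear_order_strict_le_trans:
  assumes "Linear_order r" "strictly r i j" "(j, k) \<in> r"
  shows "strictly r i k"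
  using linear_order_trans[OF assms(1), of i j k] linear_order_antisym[OF assms(1), of i j] assms(2,3)
  by auto

lemma linear_order_le_strict_trans:
  assumes "Linear_order r" "(i, j) \<in> r" "strictly r j k"
  shows "strictly r i k"
  using linear_order_trans[OF assms(1), of i j k] linear_order_antisym[OF assms(1), of j k] assms(2,3)
  by auto

lemma linear_order_strict_trans:
  "Linear_order r \<Longrightarrow> strictly r i j \<Longrightarrow> strictly r j k \<Longrightarrow> strictly r i k"
  using linear_order_strict_le_trans[of r i j k] by simp

lemma linear_order_maximum:
  assumes "Linear_order r" "finite F" "F \<noteq> {}" "F \<subseteq> Field r"
  shows "\<exists>m\<in>F. \<forall>x\<in>F - {m}. strictly r x m"
  using assms(2-)
proof (induction F rule: finite_ne_induct)
  case (insert x F)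
  then obtain m where m: "m \<in> F" "\<forall>y\<in>F - {m}. strictly r y m"
    by blast
  have "strictly r x m \<or> strictly r m x"
    using linear_order_total[OF assms(1), of x m] insert.hyps insert.prems m by blast
  then show ?case
  proof
    assume "strictly r m x"
    then have "\<forall>y\<in>insert x F - {x}. strictly r y x"
      using m linear_order_strict_trans[OF assms(1)] by blast
    then show ?thesis
      by blast
  qed (use m in blast)
qed simp

lemma increasing_enumeration:
  assumes "Linear_order r" "finite F" "F \<subseteq> Field r"
  obtains ks where "increasing r ks" "set ks = F" "length ks = card F"
proof -
  have "\<exists>ks. increasing r ks \<and> set ks = F \<and> length ks = card F"
    using assms(2,3)
  proof (induction "card F" arbitrary: F)
    case 0
    then show ?case
      by (intro exI[of _ "[]"]) auto
  next
    case (Suc n)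
    then obtain m where m: "m \<in> F" "\<forall>x\<in>F - {m}. strictly r x m"
      using linear_order_maximum[OF assms(1), of F] by fastforce
    have "n = card (F - {m})"
      using Suc m by simp
    then obtain ks where ks_F: "increasing r ks" "set ks = F - {m}" "length ks = card (F - {m})"
      using Suc by blast
    then have "increasing r (ks @ [m])"
      using m Suc.prems by (auto simp: increasing_append increasing_Cons)
    moreover have "set (ks @ [m]) = F"
      using ks_F m by auto
    ultimately show ?case
      using ks_F \<open>n = card (F - {m})\<close> Suc.hyps(2) by (intro exI[of _ "ks @ [m]"]) simp
  qed
  then show thesis
    using that by blast
qed

lemma increasing_exists:
  assumes "Linear_order r" "infinite J" "J \<subseteq> Field r"
  obtains ks where "increasing r ks" "set ks \<subseteq> J" "length ks = n"
proof -
  obtain F where "finite F" "card F = n" "F \<subseteq> J"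
    using infinite_arbitrarily_large assms(2) by metis
  then show thesis
    using increasing_enumeration[OF assms(1), of F] assms(3) that by (metis order_trans)
qed

text \<open>Any two increasing lists of the same length are joined, through their pointwise minimum,
  by changes of one entry at a time.\<close>

lemma increasing_moves:
  assumes "Linear_order r"
    and move: "\<And>u x y v. length (u @ [x] @ v) = n \<Longrightarrow> increasing r (u @ [x] @ v) \<Longrightarrow>
      increasing r (u @ [y] @ v) \<Longrightarrow> strictly r x y \<Longrightarrow> f (u @ [x] @ v) = f (u @ [y] @ v)"
    and ks: "increasing r ks" "length ks = n" and js: "increasing r js" "length js = n"
  shows "f ks = f js"
proof -
  have down: "f ms = f ks"
    if ks: "increasing r ks" "length ks = n" and ms: "increasing r ms" "length ms = n"
      and le: "\<And>k. k < n \<Longrightarrow> (ms ! k, ks ! k) \<in> r" for ms ks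
  proof -
    \<comment> \<open>These lists interpolate between \<open>ks\<close> at \<open>k = 0\<close> and
      \<open>ms\<close> at \<open>k = n\<close>. An entry of \<open>ms\<close> lies below each later
      entry of \<open>ks\<close>, since \<open>ms\<close> is increasing and pointwise below
      \<open>ks\<close>.\<close>
    have incr: "increasing r (take k ms @ drop k ks)" for k
    proof -
      have "strictly r a b" if ab: "a \<in> set (take k ms)" "b \<in> set (drop k ks)" for a b
      proof -
        obtain i where i: "i < k" "i < n" "a = ms ! i"
          using ab(1) ms(2) by (auto simp: in_set_conv_nth)
        obtain j' where "j' < length (drop k ks)" "b = drop k ks ! j'"
          using ab(2) by (auto simp: in_set_conv_nth)
        then obtain j where j: "k \<le> j" "j < n" "b = ks ! j"
          using that[of "k + j'"] ks(2) by simp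
        have "strictly r (ms ! i) (ms ! j)"
          using increasing_nth[OF ms(1)] i j ms(2) by auto
        then show ?thesis
          unfolding i(3) j(3) by (rule linear_order_strict_le_trans[OF assms(1) _ le[OF j(2)]])
      qed
      moreover have "increasing r (take k ms)" "increasing r (drop k ks)"
        using ms(1) ks(1) increasing_append[of r "take k ms" "drop k ms"]
          increasing_append[of r "take k ks" "drop k ks"] by simp_all
      ultimately show ?thesis
        by (simp add: increasing_append)
    qed
    have "f (take k ms @ drop k ks) = f ks" if "k \<le> n" for k
      using that
    proof (induction k)
      case (Suc k)
      have 1: "take (Suc k) ms @ drop (Suc k) ks = take k ms @ [ms ! k] @ drop (Suc k) ks"
        using Suc.prems ms(2) by (simp add: take_Suc_conv_app_nth)
      have 2: "take k ms @ drop k ks = take k ms @ [ks ! k] @ drop (Suc k) ks"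
        using Suc.prems ks(2) by (simp add: Cons_nth_drop_Suc)
      have "f (take k ms @ [ms ! k] @ drop (Suc k) ks) = f (take k ms @ [ks ! k] @ drop (Suc k) ks)"
      proof (cases "ms ! k = ks ! k")
        case False
        then show ?thesis
          using incr[of k] incr[of "Suc k"] Suc.prems le[of k] ks(2) ms(2) unfolding 1 2
          by (intro move[of "take k ms" "ms ! k" "drop (Suc k) ks" "ks ! k"]) simp_all
      qed simp
      then show ?case
        using Suc unfolding 1 2 by simp
    qed simp
    from this[of n] show ?thesis
      using ks(2) ms(2) by simp
  qed
  define mn where "mn = (\<lambda>i j. if (i, j) \<in> r then i else j)"
  define ms where "ms = map2 mn ks js"
  have len: "length ms = n"
    using ks(2) js(2) by (simp add: ms_def)
  have ms: "ms ! k = mn (ks ! k) (js ! k)" if "k < n" for k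
    using that ks(2) js(2) by (simp add: ms_def)
  have Field: "ks ! k \<in> Field r" "js ! k \<in> Field r" if "k < n" for k
    using that ks js increasing_set[OF ks(1)] increasing_set[OF js(1)] by (auto intro: subsetD)
  have refl: "(i, i) \<in> r" if "i \<in> Field r" for i
    using assms(1) that by (auto simp: order_on_defs refl_on_def)
  have le: "(ms ! k, ks ! k) \<in> r" "(ms ! k, js ! k) \<in> r" if "k < n" for k
  proof -
    have "(ks ! k, js ! k) \<in> r \<or> (js ! k, ks ! k) \<in> r"
      using linear_order_total[OF assms(1) Field[OF that]] refl[OF Field(1)[OF that]]
      by (cases "ks ! k = js ! k") simp_all
    then show "(ms ! k, ks ! k) \<in> r" "(ms ! k, js ! k) \<in> r"
      using refl[OF Field(1)[OF that]] refl[OF Field(2)[OF that]]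
      by (auto simp: ms[OF that] mn_def)
  qed
  \<comment> \<open>\<open>ms ! i\<close> lies strictly below both candidates for the minimum at
    \<open>j\<close>, hence below the one that is taken.\<close>
  have "strictly r (ms ! i) (ms ! j)" if "i < j" "j < n" for i j
  proof -
    have "strictly r (ks ! i) (ks ! j)" "strictly r (js ! i) (js ! j)"
      using increasing_nth[OF ks(1), of i j] increasing_nth[OF js(1), of i j] ks js that by simp_all
    then have "strictly r (ms ! i) (ks ! j)" "strictly r (ms ! i) (js ! j)"
      using linear_order_le_strict_trans[OF assms(1) le(1)[of i], of "ks ! j"]
        linear_order_le_strict_trans[OF assms(1) le(2)[of i], of "js ! j"] that by simp_all
    moreover have "ms ! j = ks ! j \<or> ms ! j = js ! j"
      using that ms[of j] by (simp add: mn_def)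
    ultimately show ?thesis
      by auto
  qed
  moreover have "set ms \<subseteq> Field r"
    using FieldI1[OF le(1)] len by (auto simp: in_set_conv_nth)
  ultimately have "increasing r ms"
    by (simp add: increasing_def sorted_wrt_iff_nth_less len)
  then show ?thesis
    using down[OF ks _ len le(1)] down[OF js _ len le(2)] by simp
qed


section \<open>Indiscernible sequences\<close>

text \<open>The sort of an entry depends on its coordinate only, which
  \<open>indiscernible_sorts\<close> derives from indiscernibility. Fixing \<open>\<tau>\<close>
  gives all subtuples of one length the same formulas. Indiscernibility is not part of the locale,
  because it is considered over varying sets.\<close>

locale sorted_sequence =
  fixes L :: "('s, 'f, 'r) language" and M :: "('s, 'f, 'r, 'm) struct"
    and r :: "'i rel" and a :: "'i \<Rightarrow> 'n \<Rightarrow> 'm" and N :: "'n set" and \<tau> :: "'n \<Rightarrow> 's"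
  assumes struct: "is_struct L M"
    and lin: "Linear_order r"
    and inf: "infinite (Field r)"
    and sorts: "i \<in> Field r \<Longrightarrow> \<nu> \<in> N \<Longrightarrow> a i \<nu> \<in> dom M (\<tau> \<nu>)"
begin

abbreviation vars :: "nat \<Rightarrow> (nat \<times> 'n) set" where
  "vars n \<equiv> {..<n} \<times> N"

abbreviation var_sort :: "nat \<times> 'n \<Rightarrow> 's" where
  "var_sort \<equiv> \<lambda>(k, \<nu>). \<tau> \<nu>"

definition points :: "'i set \<Rightarrow> 'm set" where
  "points K = {a i \<nu> | i \<nu>. i \<in> K \<and> \<nu> \<in> N}"

lemma points_mono: "K \<subseteq> K' \<Longrightarrow> points K \<subseteq> points K'"
  by (auto simp: points_def)

lemma points_Field: "points (Field r) = entries N (r, a)"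
  by (simp add: points_def entries_def)

lemma points_set: "points (set ks) = subtuple a ks ` vars (length ks)"
  by (fastforce simp: points_def subtuple_def in_set_conv_nth)

lemma fits_subtuple: "set ks \<subseteq> Field r \<Longrightarrow> fits M (vars (length ks)) var_sort (subtuple a ks)"
  using sorts nth_mem by (fastforce simp: fits_def subtuple_def)

definition indisc :: "'m set \<Rightarrow> bool" where
  "indisc B \<longleftrightarrow> (\<forall>ks js R. increasing r ks \<longrightarrow> increasing r js \<longrightarrow> length ks = length js \<longrightarrow>
     definable L M B (vars (length ks)) var_sort R \<longrightarrow>
     (R (subtuple a ks) \<longleftrightarrow> R (subtuple a js)))"

lemma indiscD:
  assumes "indisc B" "definable L M B (vars n) var_sort R"
    and "increasing r ks" "length ks = n" "increasing r js" "length js = n"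
  shows "R (subtuple a ks) \<longleftrightarrow> R (subtuple a js)"
  using assms(1)[unfolded indisc_def, rule_format, of ks js R] assms(2-) by simp

lemma tp_subtuple:
  assumes "set ks \<subseteq> Field r"
  shows "tp L M B (vars (length ks)) (subtuple a ks) =
    {\<theta> \<in> pfms L M B (vars (length ks)) var_sort. pholds M (subtuple a ks) \<theta>}"
proof -
  have "pfms L M B (vars (length ks)) (\<lambda>x. sort_of M (subtuple a ks x)) =
    pfms L M B (vars (length ks)) var_sort"
    using fits_subtuple[OF assms] sort_of_eq[OF struct] by (intro pfms_cong) (auto simp: fits_def)
  then show ?thesis
    by (simp add: tp_def)
qed

lemma indiscernible_over_iff: "indiscernible_over L M N B (r, a) \<longleftrightarrow> indisc B"
proof
  assume ind: "indiscernible_over L M N B (r, a)"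
  show "indisc B"
    unfolding indisc_def
  proof (intro allI impI)
    fix ks js R
    assume *: "increasing r ks" "increasing r js" "length ks = length js"
      "definable L M B (vars (length ks)) var_sort R"
    obtain \<theta> where \<theta>: "\<theta> \<in> pfms L M B (vars (length ks)) var_sort"
      "\<And>p. fits M (vars (length ks)) var_sort p \<Longrightarrow> R p \<longleftrightarrow> pholds M p \<theta>"
      using *(4) unfolding definable_def by blast
    let ?tp = "\<lambda>p. tp L M B (vars (length ks)) p"
    have "?tp (subtuple a ks) = ?tp (subtuple a js)"
      using ind *(1-3) unfolding indiscernible_over_def fst_conv snd_conv by blast
    moreover have "\<theta> \<in> ?tp (subtuple a ks) \<longleftrightarrow> pholds M (subtuple a ks) \<theta>"
      using \<theta>(1) by (simp add: tp_subtuple[OF increasing_set[OF *(1)]])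
    moreover have "\<theta> \<in> ?tp (subtuple a js) \<longleftrightarrow> pholds M (subtuple a js) \<theta>"
      using \<theta>(1) unfolding *(3) by (simp add: tp_subtuple[OF increasing_set[OF *(2)]])
    ultimately have "pholds M (subtuple a ks) \<theta> \<longleftrightarrow> pholds M (subtuple a js) \<theta>"
      by simp
    then show "R (subtuple a ks) \<longleftrightarrow> R (subtuple a js)"
      using \<theta>(2)[OF fits_subtuple[OF increasing_set[OF *(1)]]]
        \<theta>(2)[of "subtuple a js"] fits_subtuple[OF increasing_set[OF *(2)]] *(3) by simp
  qed
next
  assume ind: "indisc B"
  show "indiscernible_over L M N B (r, a)"
    unfolding indiscernible_over_def fst_conv snd_conv
  proof (intro allI impI)
    fix ks js
    assume "increasing r ks \<and> increasing r js \<and> length ks = length js"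
    then have *: "increasing r ks" "increasing r js" "length js = length ks"
      by simp_all
    have "pholds M (subtuple a ks) \<theta> \<longleftrightarrow> pholds M (subtuple a js) \<theta>"
      if "\<theta> \<in> pfms L M B (vars (length ks)) var_sort" for \<theta>
      using that by (rule indiscD[OF ind definable_pholds *(1) refl *(2,3)])
    then show "tp L M B (vars (length ks)) (subtuple a ks) =
      tp L M B (vars (length ks)) (subtuple a js)"
      using tp_subtuple[OF increasing_set[OF *(1)], of B]
        tp_subtuple[OF increasing_set[OF *(2)], of B] unfolding *(3) by blast
  qed
qed

lemma indisc_mono:
  assumes "indisc B" "B' \<subseteq> B"
  shows "indisc B'"
  unfolding indisc_def
proof (intro allI impI)
  fix ks js R
  assume *: "increasing r ks" "increasing r js" "length ks = length js"
    "definable L M B' (vars (length ks)) var_sort R"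
  show "R (subtuple a ks) \<longleftrightarrow> R (subtuple a js)"
    by (rule indiscD[OF assms(1) definable_mono[OF *(4) assms(2) order_refl]
          *(1) refl *(2) *(3)[symmetric]])
qed

text \<open>The elements of \<open>E\<close> have finitely many conjugates over \<open>B\<close> and the tuples at \<open>w\<close>, \<open>z\<close>. In a
  long increasing sequence two of the tuples between \<open>w'\<close> and \<open>z'\<close> satisfy \<open>R\<close> with the same
  choices of conjugates. That two tuples do so is a property over \<open>B\<close> of their order type.\<close>

lemma equivalent_in_gap:
  assumes ind: "indisc B" and incr: "increasing r (w @ [x, y] @ z)"
    and E: "E \<subseteq> acl L M (B \<union> points (set (w @ z)))"
    and R: "definable L M (B \<union> E) (vars (length w + 1 + length z)) var_sort R"
  shows "R (subtuple a (w @ [x] @ z)) \<longleftrightarrow> R (subtuple a (w @ [y] @ z))"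
proof -
  let ?nw = "length w" and ?nz = "length z" and ?\<sigma> = "sort_of M"
  obtain A0 where A0: "finite A0" "A0 \<subseteq> B \<union> E"
    "definable L M A0 (vars (?nw + 1 + ?nz)) var_sort R"
    using definable_finite_parameters[OF R] .
  define E0 where "E0 = A0 \<inter> E"
  have E0: "finite E0" "E0 \<subseteq> acl L M (B \<union> points (set (w @ z)))"
    using A0 E by (auto simp: E0_def)
  have R0: "definable L M (B \<union> E0) (vars (?nw + 1 + ?nz)) var_sort R"
    by (rule definable_mono[OF A0(3)]) (use A0(2) in \<open>auto simp: E0_def\<close>)
  have sE: "e \<in> dom M (?\<sigma> e)" if "e \<in> E0" for e
    using in_dom_sort_of[OF struct subsetD[OF acl_subset_univ subsetD[OF E0(2) that]]] .
  then have fits_id: "fits M E0 ?\<sigma> id"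
    by (simp add: fits_def)
  obtain R' where R': "definable L M B (Inl ` vars (?nw + 1 + ?nz) \<union> Inr ` E0) (case_sum var_sort ?\<sigma>) R'"
    "\<And>p. fits M (vars (?nw + 1 + ?nz)) var_sort p \<Longrightarrow> R' (case_sum p id) \<longleftrightarrow> R p"
    using definable_parameters_to_variables[OF R0 struct fits_id] by auto
  have wz: "set (w @ z) \<subseteq> Field r"
    using increasing_set[OF incr] by auto
  have "\<forall>e\<in>E0. \<exists>\<Phi> m. definable L M B (Inl ` {()} \<union> Inr ` vars (?nw + ?nz))
      (case_sum (\<lambda>_. ?\<sigma> e) var_sort) \<Phi> \<and> \<Phi> (case_sum (\<lambda>_. e) (subtuple a (w @ z))) \<and>
    (\<forall>q. finite {c \<in> dom M (?\<sigma> e). \<Phi> (case_sum (\<lambda>_. c) q)} \<and>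
      card {c \<in> dom M (?\<sigma> e). \<Phi> (case_sum (\<lambda>_. c) q)} \<le> m)"
  proof
    fix e
    assume e: "e \<in> E0"
    show "\<exists>\<Phi> m. definable L M B (Inl ` {()} \<union> Inr ` vars (?nw + ?nz))
        (case_sum (\<lambda>_. ?\<sigma> e) var_sort) \<Phi> \<and> \<Phi> (case_sum (\<lambda>_. e) (subtuple a (w @ z))) \<and>
      (\<forall>q. finite {c \<in> dom M (?\<sigma> e). \<Phi> (case_sum (\<lambda>_. c) q)} \<and>
        card {c \<in> dom M (?\<sigma> e). \<Phi> (case_sum (\<lambda>_. c) q)} \<le> m)"
      by (rule acl_tupleE[OF struct sE[OF e] subsetD[OF E0(2) e] fits_subtuple[OF wz]
            equalityD1[OF points_set]], unfold length_append, intro exI conjI)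
  qed
  from bchoice[OF this] obtain \<Phi> where "\<forall>e\<in>E0. \<exists>m. definable L M B
      (Inl ` {()} \<union> Inr ` vars (?nw + ?nz)) (case_sum (\<lambda>_. ?\<sigma> e) var_sort) (\<Phi> e) \<and>
    \<Phi> e (case_sum (\<lambda>_. e) (subtuple a (w @ z))) \<and>
    (\<forall>q. finite {c \<in> dom M (?\<sigma> e). \<Phi> e (case_sum (\<lambda>_. c) q)} \<and>
      card {c \<in> dom M (?\<sigma> e). \<Phi> e (case_sum (\<lambda>_. c) q)} \<le> m)" ..
  from bchoice[OF this] obtain m where "\<forall>e\<in>E0. definable L M B
      (Inl ` {()} \<union> Inr ` vars (?nw + ?nz)) (case_sum (\<lambda>_. ?\<sigma> e) var_sort) (\<Phi> e) \<and>
    \<Phi> e (case_sum (\<lambda>_. e) (subtuple a (w @ z))) \<and>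
    (\<forall>q. finite {c \<in> dom M (?\<sigma> e). \<Phi> e (case_sum (\<lambda>_. c) q)} \<and>
      card {c \<in> dom M (?\<sigma> e). \<Phi> e (case_sum (\<lambda>_. c) q)} \<le> m e)" ..
  then have
    \<Phi>: "\<And>e. e \<in> E0 \<Longrightarrow> definable L M B (Inl ` {()} \<union> Inr ` vars (?nw + ?nz))
        (case_sum (\<lambda>_. ?\<sigma> e) var_sort) (\<Phi> e)"
      "\<And>e. e \<in> E0 \<Longrightarrow> \<Phi> e (case_sum (\<lambda>_. e) (subtuple a (w @ z)))"
    and m: "\<And>e q. e \<in> E0 \<Longrightarrow> finite {c \<in> dom M (?\<sigma> e). \<Phi> e (case_sum (\<lambda>_. c) q)}"
      "\<And>e q. e \<in> E0 \<Longrightarrow> card {c \<in> dom M (?\<sigma> e). \<Phi> e (case_sum (\<lambda>_. c) q)} \<le> m e"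
    by simp_all
  \<comment> \<open>Positions within \<open>w @ [x, y] @ z\<close> of the entries of
    \<open>w @ [x] @ z\<close>, \<open>w @ [y] @ z\<close> and \<open>w @ z\<close>: the maps skip
    \<open>y\<close>, \<open>x\<close> and both of them.\<close>
  define gx gy gxy where "gx = (\<lambda>k. if k \<le> ?nw then k else k + 1)"
    and "gy = (\<lambda>k. if k < ?nw then k else k + 1)"
    and "gxy = (\<lambda>k. if k < ?nw then k else k + 2)"
  define QQ where "QQ = (\<lambda>p :: (nat \<times> 'n) + 'm \<Rightarrow> 'm.
    (\<forall>e\<in>E0. \<Phi> e (\<lambda>t. p (case t of Inl _ \<Rightarrow> Inr e | Inr (k, \<nu>) \<Rightarrow> Inl (gxy k, \<nu>)))) \<longrightarrow>
    (R' (\<lambda>t. p (case t of Inl (k, \<nu>) \<Rightarrow> Inl (gx k, \<nu>) | Inr e \<Rightarrow> Inr e)) \<longleftrightarrow>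
     R' (\<lambda>t. p (case t of Inl (k, \<nu>) \<Rightarrow> Inl (gy k, \<nu>) | Inr e \<Rightarrow> Inr e))))"
  \<comment> \<open>\<open>Q\<close> no longer mentions the elements of \<open>E0\<close>: it
    quantifies over all choices of candidates for them. Hence it is definable over \<open>B\<close>,
    and indiscernibility over \<open>B\<close> applies to it.\<close>
  define Q where "Q = (\<lambda>p. \<forall>d. fits M E0 ?\<sigma> d \<longrightarrow> QQ (case_sum p d))"
  have "definable L M B (Inl ` vars (?nw + 2 + ?nz) \<union> Inr ` E0) (case_sum var_sort ?\<sigma>) QQ"
    unfolding QQ_def
    by (intro definable_imp definable_iff definable_ball E0(1) definable_reindex[OF \<Phi>(1)]
        definable_reindex[OF R'(1)]) (auto simp: gx_def gy_def gxy_def)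
  then have Q: "definable L M B (vars (?nw + 2 + ?nz)) var_sort Q"
    unfolding Q_def by (rule definable_all_sum[OF struct E0(1)])
  have Q_iff: "Q (subtuple a (w' @ [x', y'] @ z')) \<longleftrightarrow> (\<forall>d. fits M E0 ?\<sigma> d \<longrightarrow>
      (\<forall>e\<in>E0. \<Phi> e (case_sum (\<lambda>_. d e) (subtuple a (w' @ z')))) \<longrightarrow>
      (R' (case_sum (subtuple a (w' @ [x'] @ z')) d) \<longleftrightarrow>
       R' (case_sum (subtuple a (w' @ [y'] @ z')) d)))"
    if "length w' = ?nw" for w' x' y' z'
  proof -
    let ?p = "subtuple a (w' @ [x', y'] @ z')"
    have 1: "\<Phi> e (\<lambda>t. case_sum ?p d (case t of Inl _ \<Rightarrow> Inr e | Inr (k, \<nu>) \<Rightarrow> Inl (gxy k, \<nu>))) =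
      \<Phi> e (case_sum (\<lambda>_. d e) (subtuple a (w' @ z')))" for d e
      using that by (intro arg_cong[of _ _ "\<Phi> e"])
        (auto simp: fun_eq_iff subtuple_def gxy_def nth_append split: sum.splits)
    have 2: "R' (\<lambda>t. case_sum ?p d (case t of Inl (k, \<nu>) \<Rightarrow> Inl (gx k, \<nu>) | Inr e \<Rightarrow> Inr e)) =
      R' (case_sum (subtuple a (w' @ [x'] @ z')) d)" for d
      using that by (intro arg_cong[of _ _ R'])
        (auto simp: fun_eq_iff subtuple_def gx_def nth_append nth_Cons' split: sum.splits)
    have 3: "R' (\<lambda>t. case_sum ?p d (case t of Inl (k, \<nu>) \<Rightarrow> Inl (gy k, \<nu>) | Inr e \<Rightarrow> Inr e)) =
      R' (case_sum (subtuple a (w' @ [y'] @ z')) d)" for d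
      using that by (intro arg_cong[of _ _ R'])
        (auto simp: fun_eq_iff subtuple_def gy_def nth_append nth_Cons' split: sum.splits)
    show ?thesis
      unfolding Q_def QQ_def 1 2 3 ..
  qed
  \<comment> \<open>\<open>P\<close> bounds the number of choices in \<open>\<Delta>\<close>. A
    tuple is classified by the subset of \<open>\<Delta>\<close> on which \<open>R'\<close> holds,
    so \<open>2 ^ P + 1\<close> tuples force a repetition.\<close>
  define P where "P = (\<Prod>e\<in>E0. m e)"
  obtain l where l: "increasing r l" "length l = ?nw + (2 ^ P + 1) + ?nz"
    using increasing_exists[OF lin inf order_refl] by metis
  define w' xs z' where "w' = take ?nw l" and "xs = take (2 ^ P + 1) (drop ?nw l)"
    and "z' = drop (?nw + (2 ^ P + 1)) l"
  have l_eq: "l = w' @ xs @ z'"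
    unfolding w'_def xs_def z'_def by (metis append_take_drop_id drop_drop add.commute)
  have len: "length w' = ?nw" "length xs = 2 ^ P + 1" "length z' = ?nz"
    using l(2) by (auto simp: w'_def xs_def z'_def)
  have incr_w'z': "increasing r (w' @ [xs ! s, xs ! t] @ z')" if "s < t" "t < length xs" for s t
    using l(1) that increasing_nth[of r xs s t] nth_mem[of s xs] nth_mem[of t xs]
    unfolding l_eq increasing_append
    by (auto simp: increasing_Cons dest!: increasing_set)
  define \<Delta> where "\<Delta> = PiE E0 (\<lambda>e. {c \<in> dom M (?\<sigma> e). \<Phi> e (case_sum (\<lambda>_. c) (subtuple a (w' @ z')))})"
  have finD: "finite \<Delta>"
    unfolding \<Delta>_def by (intro finite_PiE E0 m)
  have "card \<Delta> \<le> P"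
    unfolding \<Delta>_def P_def card_PiE[OF E0(1)] by (intro prod_mono conjI m) auto
  then have card_Pow: "card (Pow \<Delta>) \<le> 2 ^ P"
    by (simp add: card_Pow finD)
  define h where "h = (\<lambda>s. {d \<in> \<Delta>. R' (case_sum (subtuple a (w' @ [xs ! s] @ z')) d)})"
  have "\<not> inj_on h {..<2 ^ P + 1}"
  proof
    assume "inj_on h {..<2 ^ P + 1}"
    then have "card {..<2 ^ P + 1 :: nat} \<le> card (Pow \<Delta>)"
      by (rule card_inj_on_le) (use finD in \<open>auto simp: h_def\<close>)
    then show False
      using card_Pow by simp
  qed
  then obtain s t where st: "s < t" "t < length xs" "h s = h t"
    unfolding inj_on_def len by (metis lessThan_iff linorder_neqE_nat)
  have "Q (subtuple a (w' @ [xs ! s, xs ! t] @ z'))"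
    unfolding Q_iff[OF len(1)]
  proof (intro allI impI)
    fix d
    assume d: "fits M E0 ?\<sigma> d" "\<forall>e\<in>E0. \<Phi> e (case_sum (\<lambda>_. d e) (subtuple a (w' @ z')))"
    then have "restrict d E0 \<in> \<Delta>"
      by (auto simp: \<Delta>_def fits_def)
    then have *: "R' (case_sum (subtuple a (w' @ [xs ! s] @ z')) (restrict d E0)) \<longleftrightarrow>
      R' (case_sum (subtuple a (w' @ [xs ! t] @ z')) (restrict d E0))"
      using st(3) unfolding h_def by blast
    have "R' (case_sum (subtuple a (w' @ [xs ! k] @ z')) d) \<longleftrightarrow>
      R' (case_sum (subtuple a (w' @ [xs ! k] @ z')) (restrict d E0))" if "k = s \<or> k = t" for k
    proof (rule definable_depends[OF R'(1)])
      have "set (w' @ [xs ! k] @ z') \<subseteq> Field r"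
        using increasing_set[OF incr_w'z'[OF st(1,2)]] that by auto
      from fits_subtuple[OF this]
      show "fits M (Inl ` vars (?nw + 1 + ?nz) \<union> Inr ` E0) (case_sum var_sort ?\<sigma>)
        (case_sum (subtuple a (w' @ [xs ! k] @ z')) d)"
        using d(1) len by (auto simp: fits_def)
    qed auto
    then show "R' (case_sum (subtuple a (w' @ [xs ! s] @ z')) d) \<longleftrightarrow>
       R' (case_sum (subtuple a (w' @ [xs ! t] @ z')) d)"
      using * by blast
  qed
  then have "Q (subtuple a (w @ [x, y] @ z))"
    using indiscD[OF ind Q incr _ incr_w'z'[OF st(1,2)]] len by simp
  \<comment> \<open>The actual elements of \<open>E0\<close> are an admissible choice of candidates,
    namely \<open>d = id\<close>.\<close>
  then have "R' (case_sum (subtuple a (w @ [x] @ z)) id) \<longleftrightarrow> R' (case_sum (subtuple a (w @ [y] @ z)) id)"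
    using Q_iff[of w x y z] fits_id \<Phi>(2) by simp
  moreover have "R' (case_sum (subtuple a (w @ [k] @ z)) id) \<longleftrightarrow> R (subtuple a (w @ [k] @ z))"
    if "k = x \<or> k = y" for k
  proof (rule R'(2))
    have "set (w @ [k] @ z) \<subseteq> Field r"
      using increasing_set[OF incr] that by auto
    from fits_subtuple[OF this] show "fits M (vars (?nw + 1 + ?nz)) var_sort (subtuple a (w @ [k] @ z))"
      by simp
  qed
  ultimately show ?thesis
    by blast
qed

text \<open>The members at \<open>K\<close> become additional entries of the tuples: those below
  \<open>x\<close> are merged into \<open>u\<close>, those above \<open>y\<close> into
  \<open>v\<close>. As no element of \<open>K\<close> lies in the interval, \<open>x\<close> and
  \<open>y\<close> remain adjacent, and \<open>equivalent_in_gap\<close> applies to a predicate that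
  ignores the new entries.\<close>

lemma equivalent_outside:
  assumes ind: "indisc B" and incr: "increasing r (u @ [x, y] @ v)"
    and K: "finite K" "K \<subseteq> Field r" "\<forall>k\<in>K. strictly r k x \<or> strictly r y k"
    and E: "E \<subseteq> acl L M (B \<union> points K)"
    and R: "definable L M (B \<union> E) (vars (length u + 1 + length v)) var_sort R"
  shows "R (subtuple a (u @ [x] @ v)) \<longleftrightarrow> R (subtuple a (u @ [y] @ v))"
proof -
  define W Z where "W = set u \<union> {k \<in> K. strictly r k x}"
    and "Z = set v \<union> {k \<in> K. strictly r y k}"
  have xy: "x \<in> Field r" "y \<in> Field r" "strictly r x y"
    and u: "\<forall>k\<in>set u. strictly r k x" "set u \<subseteq> Field r"
    and v: "\<forall>k\<in>set v. strictly r y k" "set v \<subseteq> Field r"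
    using incr by (auto simp: increasing_append increasing_Cons dest: increasing_set)
  have W: "finite W" "W \<subseteq> Field r" "\<forall>k\<in>W. strictly r k x"
    and Z: "finite Z" "Z \<subseteq> Field r" "\<forall>k\<in>Z. strictly r y k"
    using K u v by (auto simp: W_def Z_def)
  obtain w where w: "increasing r w" "set w = W" "length w = card W"
    using increasing_enumeration[OF lin W(1,2)] .
  obtain z where z: "increasing r z" "set z = Z" "length z = card Z"
    using increasing_enumeration[OF lin Z(1,2)] .
  have Wy: "\<forall>k\<in>W. strictly r k y"
    using W(3) linear_order_strict_trans[OF lin _ xy(3)] by simp
  have xZ: "\<forall>k\<in>Z. strictly r x k"
    using Z(3) linear_order_strict_trans[OF lin xy(3)] by simp
  have WZ: "\<forall>k\<in>W. \<forall>l\<in>Z. strictly r k l"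
    using linear_order_strict_trans[OF lin bspec[OF W(3)] bspec[OF xZ]] by blast
  have incr': "increasing r (w @ [x, y] @ z)"
    using w z W Z xy Wy xZ WZ by (simp add: increasing_append increasing_Cons)
  have "K \<subseteq> set (w @ z)"
    using K(3) w(2) z(2) by (auto simp: W_def Z_def)
  then have E': "E \<subseteq> acl L M (B \<union> points (set (w @ z)))"
    by (intro order_trans[OF E] acl_mono Un_mono points_mono order_refl)
  have "\<exists>j<length w. w ! j = u ! k" if "k < length u" for k
  proof -
    have "u ! k \<in> set w"
      using that w(2) by (simp add: W_def)
    then show ?thesis
      by (simp add: in_set_conv_nth)
  qed
  then obtain g where g: "\<And>k. k < length u \<Longrightarrow> g k < length w" "\<And>k. k < length u \<Longrightarrow> w ! g k = u ! k"
    by metis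
  have "\<exists>j<length z. z ! j = v ! k" if "k < length v" for k
  proof -
    have "v ! k \<in> set z"
      using that z(2) by (simp add: Z_def)
    then show ?thesis
      by (simp add: in_set_conv_nth)
  qed
  then obtain h where h: "\<And>k. k < length v \<Longrightarrow> h k < length z" "\<And>k. k < length v \<Longrightarrow> z ! h k = v ! k"
    by metis
  \<comment> \<open>\<open>pos\<close> locates the entries of \<open>u @ [t] @ v\<close> inside
    \<open>w @ [t] @ z\<close>. The merged lists are sorted, so the entries of \<open>u\<close> and
    \<open>v\<close> may be interleaved with elements of \<open>K\<close>.\<close>
  define pos where "pos = (\<lambda>k. if k < length u then g k else if k = length u then length w
    else length w + 1 + h (k - length u - 1))"
  have pos: "pos k < length w + 1 + length z" if "k < length u + 1 + length v" for k
    using g(1)[of k] h(1)[of "k - length u - 1"] that by (auto simp: pos_def)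
  have nth_pos: "(w @ [t] @ z) ! pos k = (u @ [t] @ v) ! k" if "k < length u + 1 + length v" for k t
  proof -
    show ?thesis
      using that g[of k] h[of "k - length u - 1"]
      by (cases "k < length u"; cases "k = length u") (simp_all add: pos_def nth_append nth_Cons')
  qed
  define R' where "R' = (\<lambda>p. R (\<lambda>t. p (case t of (k, \<nu>) \<Rightarrow> (pos k, \<nu>))))"
  have R': "definable L M (B \<union> E) (vars (length w + 1 + length z)) var_sort R'"
    unfolding R'_def by (rule definable_reindex[OF R]) (use pos in auto)
  have "R (subtuple a (u @ [t] @ v)) \<longleftrightarrow> R' (subtuple a (w @ [t] @ z))" if "t = x \<or> t = y" for t
    unfolding R'_def
  proof (rule definable_depends[OF R])
    have "set (u @ [t] @ v) \<subseteq> Field r"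
      using u v xy that by auto
    from fits_subtuple[OF this]
    show "fits M (vars (length u + 1 + length v)) var_sort (subtuple a (u @ [t] @ v))"
      by simp
    show "subtuple a (u @ [t] @ v) s = subtuple a (w @ [t] @ z) (case s of (k, \<nu>) \<Rightarrow> (pos k, \<nu>))"
      if "s \<in> vars (length u + 1 + length v)" for s
      using that nth_pos[of "fst s" t] by (auto simp: subtuple_def)
  qed
  then show ?thesis
    using equivalent_in_gap[OF ind incr' E' R'] by simp
qed

section \<open>Elements algebraic over any \<open>p\<close> members\<close>

definition kernel :: "'m set \<Rightarrow> 'i set \<Rightarrow> 'm set" where
  "kernel B J = {e. \<exists>p. \<forall>K\<subseteq>J. finite K \<longrightarrow> card K = p \<longrightarrow> e \<in> acl L M (B \<union> points K)}"

text \<open>The sum of the individual numbers serves all elements: a set of that size contains a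
  subset of each required size, and \<open>acl\<close> is monotone.\<close>

lemma kernel_finite_subset:
  assumes "finite E" "E \<subseteq> kernel B J"
  obtains p where "\<forall>K\<subseteq>J. finite K \<longrightarrow> card K = p \<longrightarrow> E \<subseteq> acl L M (B \<union> points K)"
proof -
  have "\<forall>e\<in>E. \<exists>p. \<forall>K\<subseteq>J. finite K \<longrightarrow> card K = p \<longrightarrow> e \<in> acl L M (B \<union> points K)"
    using assms(2) unfolding kernel_def by blast
  from bchoice[OF this] obtain p where
    p: "\<forall>e\<in>E. \<forall>K\<subseteq>J. finite K \<longrightarrow> card K = p e \<longrightarrow> e \<in> acl L M (B \<union> points K)" ..
  have "E \<subseteq> acl L M (B \<union> points K)" if K: "K \<subseteq> J" "finite K" "card K = (\<Sum>e\<in>E. p e)" for K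
  proof
    fix e
    assume e: "e \<in> E"
    then have "p e \<le> card K"
      unfolding K(3) by (intro member_le_sum assms(1)) auto
    then obtain K' where K': "K' \<subseteq> K" "card K' = p e" "finite K'"
      by (rule obtain_subset_with_card_n)
    then have "e \<in> acl L M (B \<union> points K')"
      using p e K(1) by (meson order_trans)
    then show "e \<in> acl L M (B \<union> points K)"
      using acl_mono[OF Un_mono[OF order_refl points_mono[OF K'(1)]]] by (rule subsetD[rotated])
  qed
  then show thesis
    by (intro that[of "\<Sum>e\<in>E. p e"]) simp
qed

text \<open>If too few elements of \<open>J\<close> lie outside the interval from \<open>x\<close> to \<open>y\<close>, then \<open>J\<close> has room for
  \<open>p\<close> elements, a point \<open>m\<close>, and \<open>p\<close> more elements inside it. The move from \<open>x\<close> to \<open>m\<close> then uses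
  the upper \<open>p\<close> elements, the move from \<open>m\<close> to \<open>y\<close> the lower ones.\<close>

lemma equivalent_move:
  assumes ind: "indisc B" and J: "infinite J" "J \<subseteq> Field r"
    and E: "\<And>K. K \<subseteq> J \<Longrightarrow> finite K \<Longrightarrow> card K = p \<Longrightarrow> E \<subseteq> acl L M (B \<union> points K)"
    and R: "definable L M (B \<union> E) (vars (length u + 1 + length v)) var_sort R"
    and x: "increasing r (u @ [x] @ v)" and y: "increasing r (u @ [y] @ v)" and xy: "strictly r x y"
  shows "R (subtuple a (u @ [x] @ v)) \<longleftrightarrow> R (subtuple a (u @ [y] @ v))"
proof (cases "infinite {k \<in> J. strictly r k x \<or> strictly r y k}")
  case True
  from infinite_arbitrarily_large[OF this, of p] obtain K where
    K: "K \<subseteq> {k \<in> J. strictly r k x \<or> strictly r y k}" "finite K" "card K = p"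
    by (elim exE conjE)
  have "increasing r (u @ [x, y] @ v)"
    using x y xy by (auto simp: increasing_append increasing_Cons)
  moreover have "K \<subseteq> J" "K \<subseteq> Field r" "\<forall>k\<in>K. strictly r k x \<or> strictly r y k"
    using K(1) J(2) by auto
  ultimately show ?thesis
    by (intro equivalent_outside[OF ind _ K(2) _ _ E[OF _ K(2,3)] R])
next
  case False
  have xyF: "x \<in> Field r" "y \<in> Field r"
    using x y by (auto simp: increasing_append increasing_Cons)
  have cover: "J \<subseteq> {k \<in> J. strictly r k x \<or> strictly r y k} \<union> {x, y} \<union> {k \<in> J. strictly r x k \<and> strictly r k y}"
  proof
    fix k
    assume k: "k \<in> J"
    then have "k \<in> Field r"
      using J(2) by auto
    then show "k \<in> {k \<in> J. strictly r k x \<or> strictly r y k} \<union> {x, y} \<union>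
        {k \<in> J. strictly r x k \<and> strictly r k y}"
      using linear_order_total[OF lin xyF(1), of k] linear_order_total[OF lin xyF(2), of k] k
      by auto
  qed
  have gap: "infinite {k \<in> J. strictly r x k \<and> strictly r k y}" (is "infinite ?C")
  proof
    assume "finite ?C"
    then have "finite ({k \<in> J. strictly r k x \<or> strictly r y k} \<union> {x, y} \<union> ?C)"
      using False by simp
    from finite_subset[OF cover this] show False
      using J(1) by simp
  qed
  have "{k \<in> J. strictly r x k \<and> strictly r k y} \<subseteq> Field r"
    using J(2) by auto
  from increasing_exists[OF lin gap this] obtain l where
    l: "increasing r l" "set l \<subseteq> {k \<in> J. strictly r x k \<and> strictly r k y}"
      "length l = p + 1 + p" .
  define m where "m = l ! p"
  have l_eq: "l = take p l @ [m] @ drop (Suc p) l"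
    using l(3) id_take_nth_drop[of p l] by (simp add: m_def)
  have "increasing r (take p l @ [m] @ drop (Suc p) l)"
    using l(1) l_eq by simp
  then have incr_parts: "increasing r (take p l)" "increasing r (drop (Suc p) l)"
    "\<forall>k\<in>set (take p l). strictly r k m" "\<forall>k\<in>set (drop (Suc p) l). strictly r m k" "m \<in> Field r"
    by (auto simp: increasing_append increasing_Cons)
  have sub: "set (take p l) \<subseteq> set l" "set (drop (Suc p) l) \<subseteq> set l" "m \<in> set l"
    using l(3) by (auto simp: m_def set_take_subset set_drop_subset)
  have m: "strictly r x m" "strictly r m y"
    using l(2) sub(3) by auto
  have card: "card (set (take p l)) = p" "card (set (drop (Suc p) l)) = p"
    using incr_parts(1,2) l(3) by (simp_all add: distinct_card increasing_distinct)
  have subJ: "set (take p l) \<subseteq> J" "set (drop (Suc p) l) \<subseteq> J"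
    using sub(1,2) l(2) by blast+
  have um: "\<forall>k\<in>set u. strictly r k m" and mv: "\<forall>k\<in>set v. strictly r m k"
    using x y linear_order_strict_trans[OF lin _ m(1)] linear_order_strict_trans[OF lin m(2)]
    by (simp_all add: increasing_append increasing_Cons)
  have xm: "increasing r (u @ [x, m] @ v)" and my: "increasing r (u @ [m, y] @ v)"
    using x y um mv m incr_parts(5) by (simp_all add: increasing_append increasing_Cons)
  have "R (subtuple a (u @ [x] @ v)) \<longleftrightarrow> R (subtuple a (u @ [m] @ v))"
    by (rule equivalent_outside[OF ind xm finite_set order_trans[OF subJ(2) J(2)] _
          E[OF subJ(2) finite_set card(2)] R]) (use incr_parts(4) in simp)
  also have "\<dots> \<longleftrightarrow> R (subtuple a (u @ [y] @ v))"
    by (rule equivalent_outside[OF ind my finite_set order_trans[OF subJ(1) J(2)] _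
          E[OF subJ(1) finite_set card(1)] R]) (use incr_parts(3) in simp)
  finally show ?thesis .
qed

text \<open>A formula names finitely many elements of the kernel, for which one \<open>p\<close>
  suffices; this yields indiscernibility over the whole kernel at once. Each move may select its own
  \<open>p\<close> members, so the parameters are not tied to a fixed place of the sequence.\<close>

lemma indisc_kernel:
  assumes "indisc B" "infinite J" "J \<subseteq> Field r"
  shows "indisc (B \<union> kernel B J)"
  unfolding indisc_def
proof (intro allI impI)
  fix ks js R
  assume *: "increasing r ks" "increasing r js" "length ks = length js"
    "definable L M (B \<union> kernel B J) (vars (length ks)) var_sort R"
  obtain A0 where A0: "finite A0" "A0 \<subseteq> B \<union> kernel B J"
    "definable L M A0 (vars (length ks)) var_sort R"
    using definable_finite_parameters[OF *(4)] .
  define E where "E = A0 \<inter> kernel B J"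
  have "A0 \<subseteq> B \<union> E"
    using A0(2) by (auto simp: E_def)
  then have R: "definable L M (B \<union> E) (vars (length ks)) var_sort R"
    by (rule definable_mono[OF A0(3) _ order_refl])
  have "finite E" "E \<subseteq> kernel B J"
    using A0(1) by (auto simp: E_def)
  then obtain p where "\<forall>K\<subseteq>J. finite K \<longrightarrow> card K = p \<longrightarrow> E \<subseteq> acl L M (B \<union> points K)"
    by (rule kernel_finite_subset)
  then have p: "\<And>K. K \<subseteq> J \<Longrightarrow> finite K \<Longrightarrow> card K = p \<Longrightarrow> E \<subseteq> acl L M (B \<union> points K)"
    by simp
  show "R (subtuple a ks) \<longleftrightarrow> R (subtuple a js)"
  proof (rule increasing_moves[OF lin _ *(1) refl *(2) *(3)[symmetric]])
    fix u x y v
    assume len: "length (u @ [x] @ v) = length ks"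
      and "increasing r (u @ [x] @ v)" "increasing r (u @ [y] @ v)" "strictly r x y"
    moreover have "definable L M (B \<union> E) (vars (length u + 1 + length v)) var_sort R"
      using R unfolding len[symmetric] by simp
    ultimately show "R (subtuple a (u @ [x] @ v)) = R (subtuple a (u @ [y] @ v))"
      by (intro equivalent_move[OF assms p])
  qed
qed

lemma indisc_acl:
  assumes "indisc B"
  shows "indisc (acl L M B)"
proof (rule indisc_mono[OF indisc_kernel[OF assms inf order_refl]])
  have "B \<union> points {} = B"
    by (simp add: points_def)
  \<comment> \<open>The empty set is the only finite \<open>K\<close> with \<open>0\<close>
    elements, and it contributes no points, so \<open>p = 0\<close> works.\<close>
  then have "acl L M B \<subseteq> kernel B (Field r)"
    unfolding kernel_def by (auto intro!: exI[of _ 0])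
  then show "acl L M B \<subseteq> B \<union> kernel B (Field r)"
    by blast
qed

text \<open>Every infinite part of \<open>J'\<close> contains \<open>p\<close> members. For a
  concatenation this makes an element of the kernel algebraic over either half.\<close>

lemma kernel_subset_acl:
  assumes "infinite J" "J \<subseteq> J'"
  shows "kernel B J' \<subseteq> acl L M (B \<union> points J)"
proof
  fix d
  assume "d \<in> kernel B J'"
  then obtain p where p: "\<forall>K\<subseteq>J'. finite K \<longrightarrow> card K = p \<longrightarrow> d \<in> acl L M (B \<union> points K)"
    unfolding kernel_def by blast
  from infinite_arbitrarily_large[OF assms(1), of p] obtain K where
    K: "K \<subseteq> J" "finite K" "card K = p"
    by (elim exE conjE)
  then have "d \<in> acl L M (B \<union> points K)"
    using p order_trans[OF K(1) assms(2)] by blast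
  then show "d \<in> acl L M (B \<union> points J)"
    using acl_mono[OF Un_mono[OF order_refl points_mono[OF K(1)]]] by (rule subsetD[rotated])
qed

text \<open>The finitely many kernel elements used by a witness share one \<open>p\<close>, and over
  each choice of \<open>p\<close> members algebraic closure is idempotent. This is the essential
  inclusion of (3).\<close>

lemma acl_kernel_subset: "acl L M (kernel {} J) \<subseteq> kernel {} J"
proof
  fix d
  assume "d \<in> acl L M (kernel {} J)"
  then obtain E where E: "finite E" "E \<subseteq> kernel {} J" "d \<in> acl L M E"
    by (rule acl_finite_character[OF struct])
  obtain p where "\<forall>K\<subseteq>J. finite K \<longrightarrow> card K = p \<longrightarrow> E \<subseteq> acl L M ({} \<union> points K)"
    using kernel_finite_subset[OF E(1,2)] .
  then have p: "\<And>K. K \<subseteq> J \<Longrightarrow> finite K \<Longrightarrow> card K = p \<Longrightarrow> E \<subseteq> acl L M ({} \<union> points K)"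
    by simp
  have "d \<in> acl L M ({} \<union> points K)" if "K \<subseteq> J" "finite K" "card K = p" for K
    using subsetD[OF acl_idem[OF struct] subsetD[OF acl_mono[OF p[OF that]] E(3)]] .
  then show "d \<in> kernel {} J"
    unfolding kernel_def by (intro CollectI exI[of _ p]) simp
qed

lemma finite_subset_points:
  assumes "finite C" "C \<subseteq> points J" "J \<subseteq> Field r"
  obtains l where "increasing r l" "set l \<subseteq> J" "C \<subseteq> points (set l)"
proof -
  have "\<forall>c\<in>C. \<exists>i. i \<in> J \<and> (\<exists>\<nu>\<in>N. c = a i \<nu>)"
  proof
    fix c
    assume "c \<in> C"
    then have "c \<in> points J"
      using assms(2) by (rule subsetD[rotated])
    then show "\<exists>i. i \<in> J \<and> (\<exists>\<nu>\<in>N. c = a i \<nu>)"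
      by (auto simp: points_def)
  qed
  from bchoice[OF this] obtain h where h: "\<forall>c\<in>C. h c \<in> J \<and> (\<exists>\<nu>\<in>N. c = a (h c) \<nu>)" ..
  have fin: "finite (h ` C)" and sub: "h ` C \<subseteq> J"
    using assms(1) h by auto
  obtain l where l: "increasing r l" "set l = h ` C" "length l = card (h ` C)"
    using increasing_enumeration[OF lin fin order_trans[OF sub assms(3)]] .
  moreover have "C \<subseteq> points (set l)"
    unfolding l(2) points_def using h by blast
  ultimately show thesis
    using that sub by simp
qed

text \<open>Indiscernibility over \<open>d\<close> carries the formula that witnesses algebraicity of \<open>d\<close> from one
  increasing tuple to all others.\<close>

lemma algebraic_in_kernel:
  assumes d: "d \<in> acl L M (points (Field r))" and ind: "indisc {d}"
  shows "d \<in> kernel {} (Field r)"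
proof -
  have s: "d \<in> dom M (sort_of M d)"
    by (rule in_dom_sort_of[OF struct subsetD[OF acl_subset_univ d]])
  obtain C where C: "finite C" "C \<subseteq> points (Field r)" "d \<in> acl L M C"
    using acl_finite_character[OF struct d] .
  obtain l where l: "increasing r l" "set l \<subseteq> Field r" "C \<subseteq> points (set l)"
    using finite_subset_points[OF C(1,2) order_refl] .
  have "{} \<union> C \<subseteq> {} \<union> points (set l)"
    using l(3) by simp
  then have d': "d \<in> acl L M ({} \<union> points (set l))"
    using acl_mono C(3) by fastforce
  obtain \<Phi> m where \<Phi>: "definable L M {} (Inl ` {()} \<union> Inr ` vars (length l))
      (case_sum (\<lambda>_. sort_of M d) var_sort) \<Phi>"
    "\<Phi> (case_sum (\<lambda>_. d) (subtuple a l))"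
    "\<forall>q. finite {c \<in> dom M (sort_of M d). \<Phi> (case_sum (\<lambda>_. c) q)} \<and>
      card {c \<in> dom M (sort_of M d). \<Phi> (case_sum (\<lambda>_. c) q)} \<le> m"
    using acl_tupleE[OF struct s d' fits_subtuple[OF l(2)] equalityD1[OF points_set]] .
  have eq: "(\<lambda>t. case_sum p id (case_sum (\<lambda>_. Inr d) Inl t)) = case_sum (\<lambda>_. d) p" for p
    by (auto simp: fun_eq_iff split: sum.splits)
  \<comment> \<open>Now \<open>d\<close> is the parameter and the tuple is variable, so that
    indiscernibility over \<open>d\<close> can move the tuple.\<close>
  have "definable L M {d} (vars (length l)) var_sort
    (\<lambda>p. \<Phi> (\<lambda>t. case_sum p id (case_sum (\<lambda>_. Inr d) Inl t)))"
    by (rule definable_subst[OF \<Phi>(1)]) (use s in auto)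
  then have R: "definable L M {d} (vars (length l)) var_sort (\<lambda>p. \<Phi> (case_sum (\<lambda>_. d) p))"
    by (rule definable_cong) (rule arg_cong[of _ _ \<Phi>], rule eq)
  \<comment> \<open>The bound in \<open>\<Phi>\<close> is uniform, so at the new tuple
    \<open>l'\<close> the solutions, \<open>d\<close> among them, are still finite in number. This
    gives \<open>p = length l\<close>.\<close>
  have "d \<in> acl L M ({} \<union> points K)" if K: "K \<subseteq> Field r" "finite K" "card K = length l" for K
  proof -
    obtain l' where l': "increasing r l'" "set l' = K" "length l' = card K"
      using increasing_enumeration[OF lin K(2,1)] .
    then have len: "length l' = length l"
      using K(3) by simp
    have \<Phi>': "\<Phi> (case_sum (\<lambda>_. d) (subtuple a l'))"
      using indiscD[OF ind R l(1) refl l'(1) len] \<Phi>(2) by simp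
    have fits: "fits M (vars (length l)) var_sort (subtuple a l')"
      using fits_subtuple[OF increasing_set[OF l'(1)]] unfolding len .
    have "subtuple a l' ` vars (length l) \<subseteq> {} \<union> points K"
      using points_set[of l'] unfolding len l'(2) by simp
    then show ?thesis
      using \<Phi>(3) by (intro acl_tupleI[OF struct s fits empty_subsetI _ \<Phi>(1) \<Phi>']) simp_all
  qed
  then show ?thesis
    unfolding kernel_def by (intro CollectI exI[of _ "length l"]) simp
qed

lemma aker_eq_kernel:
  assumes "indisc {}"
  shows "aker L M N (r, a) = kernel {} (Field r)"
proof
  show "aker L M N (r, a) \<subseteq> kernel {} (Field r)"
    using algebraic_in_kernel
    by (auto simp: aker_def indiscernible_over_iff points_Field)
  show "kernel {} (Field r) \<subseteq> aker L M N (r, a)"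
  proof
    fix d
    assume d: "d \<in> kernel {} (Field r)"
    have "d \<in> acl L M (entries N (r, a))"
      using subsetD[OF kernel_subset_acl[OF inf order_refl] d] by (simp add: points_Field)
    moreover have "indisc {d}"
      by (rule indisc_mono[OF indisc_kernel[OF assms inf order_refl]]) (use d in simp)
    ultimately show "d \<in> aker L M N (r, a)"
      by (simp add: aker_def indiscernible_over_iff)
  qed
qed

end

section \<open>A sequence embedded in an indiscernible one, such as a summand of a
  concatenation\<close>

locale embedded_sequence = sorted_sequence L M r a N \<tau>
  for L :: "('s, 'f, 'r) language" and M :: "('s, 'f, 'r, 'm) struct"
    and r :: "'i rel" and a :: "'i \<Rightarrow> 'n \<Rightarrow> 'm" and N :: "'n set" and \<tau> :: "'n \<Rightarrow> 's" +
  fixes f :: "'j \<Rightarrow> 'i" and q :: "'j rel" and b :: "'j \<Rightarrow> 'n \<Rightarrow> 'm"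
  assumes lin_q: "Linear_order q"
    and inf_q: "infinite (Field q)"
    and f_inj: "inj f"
    and f_Field: "i \<in> Field q \<Longrightarrow> f i \<in> Field r"
    and f_mono: "(i, j) \<in> q \<Longrightarrow> (f i, f j) \<in> r"
    and f_eq: "a (f i) = b i"
    and ind: "indisc {}"
begin

sublocale sub: sorted_sequence L M q b N \<tau>
proof
  show "b i \<nu> \<in> dom M (\<tau> \<nu>)" if "i \<in> Field q" "\<nu> \<in> N" for i \<nu>
    using sorts[OF f_Field[OF that(1)] that(2)] by (simp add: f_eq)
qed (rule struct lin_q inf_q)+

lemma increasing_map: "increasing q ks \<Longrightarrow> increasing r (map f ks)"
proof (induction ks)
  case (Cons k ks)
  then show ?case
    using f_Field f_mono by (auto simp: increasing_Cons inj_eq[OF f_inj])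
qed simp

lemma sub_points: "sub.points K = points (f ` K)"
  by (auto simp: points_def sub.points_def f_eq) (metis f_eq imageI, blast)

lemma sub_indisc_empty: "sub.indisc {}"
  unfolding sub.indisc_def
proof (intro allI impI)
  fix ks js R
  assume *: "increasing q ks" "increasing q js" "length ks = length js"
    "definable L M {} ({..<length ks} \<times> N) (\<lambda>(k, \<nu>). \<tau> \<nu>) R"
  have eq: "R (subtuple b ls) \<longleftrightarrow> R (subtuple a (map f ls))"
    if ls: "increasing q ls" "length ls = length ks" for ls
  proof (rule definable_depends[OF *(4)])
    show "fits M ({..<length ks} \<times> N) (\<lambda>(k, \<nu>). \<tau> \<nu>) (subtuple b ls)"
      using sub.fits_subtuple[OF increasing_set[OF ls(1)]] unfolding ls(2) .
  qed (use ls in \<open>auto simp: subtuple_def f_eq\<close>)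
  show "R (subtuple b ks) \<longleftrightarrow> R (subtuple b js)"
    unfolding eq[OF *(1) refl] eq[OF *(2) *(3)[symmetric]]
    by (rule indiscD[OF ind *(4) increasing_map[OF *(1)] _ increasing_map[OF *(2)]])
      (use *(3) in simp_all)
qed

text \<open>An element \<open>d\<close> of the kernel of the part is algebraic over any
  \<open>p\<close> members with index in the image of \<open>f\<close>, an infinite set of indices
  of the large sequence. By \<open>indisc_kernel\<close> the large sequence is then indiscernible
  over \<open>d\<close>. So \<open>d\<close> lies in the kernel of the large sequence as well, and
  is algebraic over any infinite set of members, even one disjoint from the part.\<close>

lemma aker_subset_acl:
  assumes "infinite J" "J \<subseteq> Field r"
  shows "aker L M N (q, b) \<subseteq> acl L M (points J)"
proof
  fix d
  assume "d \<in> aker L M N (q, b)"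
  then have "d \<in> sub.kernel {} (Field q)"
    by (simp add: sub.aker_eq_kernel[OF sub_indisc_empty])
  then obtain p where p: "\<forall>K\<subseteq>Field q. finite K \<longrightarrow> card K = p \<longrightarrow> d \<in> acl L M ({} \<union> sub.points K)"
    unfolding sub.kernel_def by blast
  have "d \<in> acl L M ({} \<union> points K)" if K: "K \<subseteq> f ` Field q" "finite K" "card K = p" for K
  proof -
    obtain K' where K': "K' \<subseteq> Field q" "K = f ` K'"
      using K(1) by (auto simp: subset_image_iff)
    have "inj_on f K'"
      using f_inj by (rule inj_on_subset) simp
    then have "finite K'" "card K' = p"
      using K K'(2) by (auto simp: card_image dest: finite_imageD)
    then show ?thesis
      using p K'(1) by (simp add: K'(2) sub_points)
  qed
  then have d: "d \<in> kernel {} (f ` Field q)"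
    unfolding kernel_def by (intro CollectI exI[of _ p]) simp
  have inf_f: "infinite (f ` Field q)"
    using inf_q finite_imageD[OF _ inj_on_subset[OF f_inj subset_UNIV]] by auto
  have f_sub: "f ` Field q \<subseteq> Field r"
    using f_Field by auto
  have "indisc {d}"
    by (rule indisc_mono[OF indisc_kernel[OF ind inf_f f_sub]]) (use d in simp)
  moreover have "d \<in> acl L M (points (Field r))"
    using subsetD[OF kernel_subset_acl[OF inf_f order_refl] d] acl_mono[OF points_mono[OF f_sub]]
    by auto
  ultimately have "d \<in> kernel {} (Field r)"
    by (intro algebraic_in_kernel)
  from subsetD[OF kernel_subset_acl[OF assms] this] show "d \<in> acl L M (points J)"
    by simp
qed

text \<open>Finitely many parameters sit at an increasing list \<open>l\<close> on one side of the
  image. Attaching \<open>l\<close> on that side to the image of an increasing list gives an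
  increasing list of the large sequence, to which indiscernibility over the empty set
  applies.\<close>

lemma sub_indisc_points:
  assumes J: "J \<subseteq> Field r"
    and sep: "(\<forall>i\<in>Field q. \<forall>j\<in>J. strictly r (f i) j) \<or> (\<forall>i\<in>Field q. \<forall>j\<in>J. strictly r j (f i))"
      (is "?before \<or> _")
  shows "sub.indisc (points J)"
  unfolding sub.indisc_def
proof (intro allI impI)
  fix ks js R
  assume *: "increasing q ks" "increasing q js" "length ks = length js"
    and "definable L M (points J) ({..<length ks} \<times> N) (\<lambda>(k, \<nu>). \<tau> \<nu>) R"
  define n where "n = length ks"
  have R: "definable L M (points J) (vars n) var_sort R"
    unfolding n_def by fact
  obtain C where C: "finite C" "C \<subseteq> points J" "definable L M C (vars n) var_sort R"
    using definable_finite_parameters[OF R] .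
  obtain l where l: "increasing r l" "set l \<subseteq> J" "C \<subseteq> points (set l)"
    using finite_subset_points[OF C(1,2) J] .
  define m where "m = length l"
  have R0: "definable L M ({} \<union> C) (vars n) var_sort R"
    using C(3) by simp
  have C': "C \<subseteq> subtuple a l ` vars (length l)"
    using l(3) by (simp add: points_set)
  obtain R' where R': "definable L M {} (Inl ` vars n \<union> Inr ` vars (length l)) (case_sum var_sort var_sort) R'"
    "\<And>p. fits M (vars n) var_sort p \<Longrightarrow> R' (case_sum p (subtuple a l)) \<longleftrightarrow> R p"
    using definable_parameters_to_variables[OF R0 struct fits_subtuple[OF increasing_set[OF l(1)]] C']
    by auto
  define before where "before \<longleftrightarrow> ?before"
  define join where "join = (\<lambda>ls. if before then map f ls @ l else l @ map f ls)"
  \<comment> \<open>Positions in \<open>join ls\<close> of the moving entries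
    (\<open>\<alpha>\<close>) and of the fixed list \<open>l\<close> (\<open>\<beta>\<close>),
    depending on the side of \<open>l\<close>.\<close>
  define \<alpha> \<beta> where "\<alpha> = (\<lambda>k. if before then k else m + k)"
    and "\<beta> = (\<lambda>k. if before then n + k else k)"
  define Q where "Q = (\<lambda>p. R' (\<lambda>t. p (case t of Inl (k, \<nu>) \<Rightarrow> (\<alpha> k, \<nu>) | Inr (k, \<nu>) \<Rightarrow> (\<beta> k, \<nu>))))"
  have Q: "definable L M {} (vars (n + m)) var_sort Q"
    unfolding Q_def
    by (rule definable_reindex[OF R'(1)]) (auto simp: \<alpha>_def \<beta>_def m_def)
  have Q_iff: "Q (subtuple a (join ls)) \<longleftrightarrow> R (subtuple b ls)"
    if ls: "increasing q ls" "length ls = n" for ls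
  proof -
    have fits: "fits M (vars n) var_sort (subtuple b ls)"
      using sub.fits_subtuple[OF increasing_set[OF ls(1)]] unfolding ls(2) .
    have "R' (case_sum (subtuple b ls) (subtuple a l)) \<longleftrightarrow> Q (subtuple a (join ls))"
      unfolding Q_def
    proof (rule definable_depends[OF R'(1)])
      show "fits M (Inl ` vars n \<union> Inr ` vars (length l)) (case_sum var_sort var_sort)
        (case_sum (subtuple b ls) (subtuple a l))"
        using fits fits_subtuple[OF increasing_set[OF l(1)]] by (auto simp: fits_def)
    qed (use ls(2) in \<open>auto simp: subtuple_def join_def \<alpha>_def \<beta>_def m_def nth_append f_eq\<close>)
    then show ?thesis
      using R'(2)[OF fits] by simp
  qed
  have join: "increasing r (join ls)" if ls: "increasing q ls" for ls
  proof (cases before)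
    case True
    then have "\<forall>i\<in>Field q. \<forall>j\<in>J. strictly r (f i) j"
      by (simp add: before_def)
    then show ?thesis
      using True increasing_map[OF ls] l increasing_set[OF ls]
      by (auto simp: join_def increasing_append subset_iff)
  next
    case False
    then have "\<forall>i\<in>Field q. \<forall>j\<in>J. strictly r j (f i)"
      using sep unfolding before_def[symmetric] by simp
    then show ?thesis
      using False increasing_map[OF ls] l increasing_set[OF ls]
      by (auto simp: join_def increasing_append subset_iff)
  qed
  have len: "length (join ls) = n + m" if "length ls = n" for ls
    using that by (simp add: join_def m_def)
  have ks: "length ks = n" and js: "length js = n"
    using *(3) by (simp_all add: n_def)
  show "R (subtuple b ks) \<longleftrightarrow> R (subtuple b js)"
    using indiscD[OF ind Q join[OF *(1)] len[OF ks] join[OF *(2)] len[OF js]]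
    by (simp only: Q_iff[OF *(1) ks] Q_iff[OF *(2) js])
qed

lemma aker_eq_acl_inter:
  assumes "infinite J" "J \<subseteq> Field r"
    and "(\<forall>i\<in>Field q. \<forall>j\<in>J. strictly r (f i) j) \<or> (\<forall>i\<in>Field q. \<forall>j\<in>J. strictly r j (f i))"
  shows "aker L M N (q, b) = acl L M (entries N (q, b)) \<inter> acl L M (points J)"
proof
  show "aker L M N (q, b) \<subseteq> acl L M (entries N (q, b)) \<inter> acl L M (points J)"
    using aker_subset_acl[OF assms(1,2)] by (auto simp: aker_def)
  have "sub.indisc (acl L M (points J))"
    by (rule sub.indisc_acl[OF sub_indisc_points[OF assms(2,3)]])
  then have "sub.indisc {d}" if "d \<in> acl L M (points J)" for d
    by (rule sub.indisc_mono) (use that in simp)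
  then show "acl L M (entries N (q, b)) \<inter> acl L M (points J) \<subseteq> aker L M N (q, b)"
    by (auto simp: aker_def sub.indiscernible_over_iff)
qed

end

text \<open>A type in the sense of \<open>tp\<close> determines sorts, as it contains only formulas
  whose variables match the sorts of the tuple. So the trivial formula
  \<open>Eq (Var ?v) (Var ?v)\<close> tests the sort, and every member agrees with the one at a
  reference index \<open>i0\<close>.\<close>

lemma indiscernible_sorts:
  assumes struct: "is_struct L M" and lin: "Linear_order r" and inf: "infinite (Field r)"
    and univ: "entries N (r, a) \<subseteq> univ M" and ind: "indiscernible_over L M N {} (r, a)"
  obtains \<tau> where "sorted_sequence L M r a N \<tau>"
proof -
  obtain i0 where i0: "i0 \<in> Field r"
    using inf by (cases "Field r = {}") auto
  have "a i \<nu> \<in> dom M (sort_of M (a i0 \<nu>))" if i: "i \<in> Field r" and \<nu>: "\<nu> \<in> N" for i \<nu>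
  proof -
    have "a i \<nu> \<in> univ M"
      using univ i \<nu> by (auto simp: entries_def)
    then have dom: "a i \<nu> \<in> dom M (sort_of M (a i \<nu>))"
      by (rule in_dom_sort_of[OF struct])
    let ?v = "(sort_of M (a i \<nu>), 0)"
    let ?\<theta> = "(Eq (Var ?v) (Var ?v), \<lambda>_. Inl (0, \<nu>))"
    have "tp L M {} ({..<length [i]} \<times> N) (subtuple a [i]) =
      tp L M {} ({..<length [i]} \<times> N) (subtuple a [i0])"
      using ind[unfolded indiscernible_over_def, rule_format, of "[i]" "[i0]"] i i0
      by (simp add: increasing_Cons)
    moreover have "?\<theta> \<in> tp L M {} ({..<length [i]} \<times> N) (subtuple a [i])"
      using \<nu> by (simp add: tp_def pfms_def subtuple_def)
    ultimately have "?\<theta> \<in> tp L M {} ({..<length [i]} \<times> N) (subtuple a [i0])"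
      by simp
    then have "sort_of M (a i0 \<nu>) = sort_of M (a i \<nu>)"
      by (simp add: tp_def pfms_def subtuple_def)
    then show ?thesis
      using dom by simp
  qed
  then have "sorted_sequence L M r a N (\<lambda>\<nu>. sort_of M (a i0 \<nu>))"
    using struct lin inf by unfold_locales
  then show thesis
    by (rule that)
qed


section \<open>Concatenations\<close>

lemma Field_concat_order: "Field (concat_order r r') = Inl ` Field r \<union> Inr ` Field r'"
  unfolding concat_order_def Field_def by force

lemma in_concat_order:
  "(Inl i, Inl j) \<in> concat_order r r' \<longleftrightarrow> (i, j) \<in> r"
  "(Inr k, Inr l) \<in> concat_order r r' \<longleftrightarrow> (k, l) \<in> r'"
  "(Inl i, Inr l) \<in> concat_order r r' \<longleftrightarrow> i \<in> Field r \<and> l \<in> Field r'"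
  "(Inr k, Inl j) \<notin> concat_order r r'"
  unfolding concat_order_def by force+

lemma Linear_order_concat_order:
  assumes "Linear_order r" "Linear_order r'"
  shows "Linear_order (concat_order r r')"
  unfolding order_on_defs
proof (intro conjI)
  have r: "refl_on (Field r) r" "trans r" "antisym r" "total_on (Field r) r"
    and r': "refl_on (Field r') r'" "trans r'" "antisym r'" "total_on (Field r') r'"
    using assms by (auto simp: order_on_defs)
  show "concat_order r r' \<subseteq> Field (concat_order r r') \<times> Field (concat_order r r')"
    by (auto intro: FieldI1 FieldI2)
  show "refl_on (Field (concat_order r r')) (concat_order r r')"
    using r(1) r'(1) by (auto simp: refl_on_def Field_concat_order in_concat_order)
  show "trans (concat_order r r')"
  proof (rule transI)
    fix x y z
    assume "(x, y) \<in> concat_order r r'" "(y, z) \<in> concat_order r r'"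
    then show "(x, z) \<in> concat_order r r'"
      by (cases x; cases y; cases z; simp add: in_concat_order;
          meson FieldI1 FieldI2 transD[OF r(2)] transD[OF r'(2)])
  qed
  show "antisym (concat_order r r')"
  proof (rule antisymI)
    fix x y
    assume "(x, y) \<in> concat_order r r'" "(y, x) \<in> concat_order r r'"
    then show "x = y"
      by (cases x; cases y; simp add: in_concat_order; meson antisymD[OF r(3)] antisymD[OF r'(3)])
  qed
  show "total_on (Field (concat_order r r')) (concat_order r r')"
    using r(4) r'(4) unfolding total_on_def Field_concat_order
    by (auto simp: in_concat_order; blast)
qed

text \<open>Each half is embedded in the concatenation and lies entirely on one side of the other
  half. Both equations are proved for one order, since the two sequences enter it asymmetrically;
  the other case of clean collinearity is then an exchange of names.\<close>

lemma aker_concat: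
  fixes S :: "('i, 'n, 'm) seq" and S' :: "('j, 'n, 'm) seq"
  assumes struct: "is_struct L M"
    and S: "indiscernible_seq \<kappa> L M N S" and S': "indiscernible_seq \<kappa>' L M N S'"
    and concat: "indiscernible_over L M N {} (concat_seq S S')"
  shows "aker L M N S = acl L M (entries N S) \<inter> acl L M (entries N S')"
    and "aker L M N S' = acl L M (entries N S') \<inter> acl L M (entries N S)"
proof -
  obtain r a where S_eq: "S = (r, a)"
    by (cases S)
  obtain r' a' where S'_eq: "S' = (r', a')"
    by (cases S')
  have r: "Linear_order r" "infinite (Field r)" "entries N (r, a) \<subseteq> univ M"
    and r': "Linear_order r'" "infinite (Field r')" "entries N (r', a') \<subseteq> univ M"
    using S S' by (simp_all add: indiscernible_seq_def S_eq S'_eq)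
  let ?R = "concat_order r r'" and ?A = "case_sum a a'"
  have lin: "Linear_order ?R"
    by (rule Linear_order_concat_order[OF r(1) r'(1)])
  have inf_Inl: "infinite (Inl ` Field r :: ('i + 'j) set)"
    and inf_Inr: "infinite (Inr ` Field r' :: ('i + 'j) set)"
    using r(2) r'(2) finite_imageD[of Inl "Field r"] finite_imageD[of Inr "Field r'"]
    by (auto simp: inj_on_def)
  have inf: "infinite (Field ?R)"
    using inf_Inl by (simp add: Field_concat_order)
  have "entries N (?R, ?A) \<subseteq> entries N (r, a) \<union> entries N (r', a')"
    by (auto simp: entries_def Field_concat_order; blast)
  then have univ: "entries N (?R, ?A) \<subseteq> univ M"
    using r(3) r'(3) by (meson Un_least order_trans)
  have ind: "indiscernible_over L M N {} (?R, ?A)"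
    using concat by (simp add: concat_seq_def S_eq S'_eq)
  obtain \<tau> where "sorted_sequence L M ?R ?A N \<tau>"
    using indiscernible_sorts[OF struct lin inf univ ind] .
  then interpret sorted_sequence L M ?R ?A N \<tau> .
  have indisc: "indisc {}"
    using ind by (simp add: indiscernible_over_iff)
  interpret left: embedded_sequence L M ?R ?A N \<tau> Inl r a
    by unfold_locales
      (use r indisc in \<open>auto simp: Field_concat_order in_concat_order\<close>)
  interpret right: embedded_sequence L M ?R ?A N \<tau> Inr r' a'
    by unfold_locales
      (use r' indisc in \<open>auto simp: Field_concat_order in_concat_order\<close>)
  have "points (Inr ` Field r') = entries N S'"
    unfolding right.sub_points[symmetric] right.sub.points_Field S'_eq ..
  moreover have "points (Inl ` Field r) = entries N S"
    unfolding left.sub_points[symmetric] left.sub.points_Field S_eq ..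
  moreover have
    "aker L M N (r, a) = acl L M (entries N (r, a)) \<inter> acl L M (points (Inr ` Field r'))"
    by (rule left.aker_eq_acl_inter[OF inf_Inr])
      (auto simp: Field_concat_order in_concat_order)
  moreover have
    "aker L M N (r', a') = acl L M (entries N (r', a')) \<inter> acl L M (points (Inl ` Field r))"
    by (rule right.aker_eq_acl_inter[OF inf_Inl])
      (auto simp: Field_concat_order in_concat_order)
  ultimately show "aker L M N S = acl L M (entries N S) \<inter> acl L M (entries N S')"
    and "aker L M N S' = acl L M (entries N S') \<inter> acl L M (entries N S)"
    by (simp_all add: S_eq S'_eq)
qed

lemma aker_cleanly_collinear:
  assumes "is_struct L M" "cleanly_collinear \<kappa> L M N S S'"
  shows "aker L M N S = acl L M (entries N S) \<inter> acl L M (entries N S')"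
    and "aker L M N S' = acl L M (entries N S') \<inter> acl L M (entries N S)"
proof -
  have S: "indiscernible_seq \<kappa> L M N S" and S': "indiscernible_seq \<kappa> L M N S'"
    and "indiscernible_over L M N {} (concat_seq S S') \<or>
      indiscernible_over L M N {} (concat_seq S' S)"
    using assms(2) by (simp_all add: cleanly_collinear_def)
  then show "aker L M N S = acl L M (entries N S) \<inter> acl L M (entries N S')"
    and "aker L M N S' = acl L M (entries N S') \<inter> acl L M (entries N S)"
    using aker_concat[OF assms(1) S S'] aker_concat[OF assms(1) S' S] by auto
qed

text \<open>Along each link of the chain both kernels are the intersection of the same two
  closures.\<close>

lemma aker_approx:
  assumes "is_struct L M" "approx \<kappa> L M N S S'"
  shows "aker L M N S = aker L M N S'"
  using assms(2) unfolding approx_def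
proof (induction rule: tranclp_induct)
  case (base S')
  then show ?case
    using aker_cleanly_collinear[OF assms(1) base] by (simp add: Int_commute)
next
  case (step S' S'')
  then show ?case
    using aker_cleanly_collinear[OF assms(1) step(2)] by (simp add: Int_commute)
qed

theorem theorem3p11:
  fixes L :: "('s, 'f, 'r) language"
    and T :: "('s, 'f, 'r) fm set"
    and M :: "('s, 'f, 'r, 'm) struct"
    and \<kappa> :: "'i rel"
    and N :: "'n set"
    and S S' :: "('i, 'n, 'm) seq"
  assumes "complete_consistent_theory L T"
    and "big_saturated_model \<kappa> L T M"
    and "|N| <o \<kappa>"
    and "indiscernible_seq \<kappa> L M N S"
    and "indiscernible_seq \<kappa> L M N S'"
  shows "(approx \<kappa> L M N S S' \<longrightarrow> aker L M N S = aker L M N S') \<and>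
    (cleanly_collinear \<kappa> L M N S S' \<longrightarrow>
       aker L M N S = acl L M (entries N S) \<inter> acl L M (entries N S')) \<and>
    aker L M N S = acl L M (aker L M N S) \<and>
    indiscernible_over L M N (aker L M N S) S"
proof -
  have struct: "is_struct L M"
    using assms(2) by (simp add: big_saturated_model_def is_model_def)
  obtain r a where S: "S = (r, a)"
    by (cases S)
  have r: "Linear_order r" "infinite (Field r)" "entries N (r, a) \<subseteq> univ M"
    "indiscernible_over L M N {} (r, a)"
    using assms(4) by (simp_all add: indiscernible_seq_def S)
  obtain \<tau> where "sorted_sequence L M r a N \<tau>"
    using indiscernible_sorts[OF struct r] .
  then interpret sorted_sequence L M r a N \<tau> .
  have ind: "indisc {}"
    using r(4) by (simp add: indiscernible_over_iff)
  have aker: "aker L M N S = kernel {} (Field r)"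
    using aker_eq_kernel[OF ind] by (simp add: S)
  \<comment> \<open>\<open>subset_acl\<close> speaks about subsets of the universe; algebraic
    elements belong to it by definition.\<close>
  have "aker L M N S \<subseteq> univ M"
    using acl_subset_univ[of L M "entries N S"] by (auto simp: aker_def)
  then have "aker L M N S = acl L M (aker L M N S)"
    using subset_acl[OF struct] acl_kernel_subset unfolding aker by (intro equalityI)
  moreover have "indiscernible_over L M N (aker L M N S) S"
    using indisc_kernel[OF ind inf order_refl] unfolding aker by (simp add: S indiscernible_over_iff)
  ultimately show ?thesis
    using aker_approx[OF struct, of \<kappa> N S S'] aker_cleanly_collinear(1)[OF struct, of \<kappa> N S S']
    by (intro conjI impI)
qed

end
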